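(* Let $n \ge 2$, let $D \subset \mathbb{R}^n$ be a bounded domain with $C^\infty$ boundary, and let $p \ge 1$. Let $u \in L^p(D) \cap W^{1,2}_0(D)$, $u \not\equiv 0$, be a critical point of the functional $$\Phi_p(u) = \frac{\int_D |\nabla u|^2 \, dV}{\left( \int_D u^p \, dV \right)^{2/p}}$$ on $L^p(D) \cap W^{1,2}_0(D)$. Then there is a constant $\Lambda$ such that $$\Delta u + \Lambda u^{p-1} = 0 \ \text{ in } D, \qquad u|_{\partial D} = 0.$$
   Context: A domain is a nonempty connected open set. The functional satisfies $\Phi_p(u) = \|\nabla u\|_{L^2(D)}^2 / \|u\|_{L^p(D)}^2$; thus for functions that may change sign $u^p$ is read as $|u|^p$, and correspondingly $u^{p-1}$ is read as $|u|^{p-2}u$ (for $u>0$ these are the usual powers). A critical point of $\Phi_p$ is a nonzero $u \in L^p(D)\cap W^{1,2}_0(D)$ such that for all $v \in L^p(D)\cap W^{1,2}_0(D)$ the derivative $\frac{d}{d\epsilon}\big|_{\epsilon=0}\Phi_p(u+\epsilon v)$ exists and equals $0$. The equation is understood in the weak sense, $\int_D \left(-\langle \nabla u, \nabla v\rangle + \Lambda u^{p-1} v\right) dV = 0$ for all $v\in C_0^\infty(D)$, and the boundary condition is expressed by $u \in W^{1,2}_0(D)$. *)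

theory Defs
  imports "HOL-Analysis.Analysis"
begin

section \<open>Smooth functions and test functions\<close>

text \<open>\<open>Ck_on S f k\<close> is meant for open \<open>S\<close>; on such sets it is the usual class of
  \<open>k\<close> times continuously differentiable functions.\<close>

primrec Ck_on :: "'a::euclidean_space set \<Rightarrow> ('a \<Rightarrow> real) \<Rightarrow> nat \<Rightarrow> bool" where
  "Ck_on S f 0 \<longleftrightarrow> continuous_on S f"
| "Ck_on S f (Suc k) \<longleftrightarrow> (\<forall>x\<in>S. f differentiable (at x)) \<and>
     (\<forall>v. Ck_on S (\<lambda>x. frechet_derivative f (at x) v) k)"

definition smooth_on :: "'a::euclidean_space set \<Rightarrow> ('a \<Rightarrow> real) \<Rightarrow> bool" where
  "smooth_on S f \<longleftrightarrow> (\<forall>k. Ck_on S f k)"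

definition grad :: "('a::euclidean_space \<Rightarrow> real) \<Rightarrow> 'a \<Rightarrow> 'a" where
  "grad f x = (\<Sum>b\<in>Basis. frechet_derivative f (at x) b *\<^sub>R b)"

text \<open>The space \<open>C\<^sub>0\<^sup>\<infinity>(D)\<close>, its elements being extended by zero to the whole space.\<close>

definition test_functions :: "'a::euclidean_space set \<Rightarrow> ('a \<Rightarrow> real) set" where
  "test_functions D =
     {f. smooth_on UNIV f \<and> compact (closure {x. f x \<noteq> 0}) \<and> closure {x. f x \<noteq> 0} \<subseteq> D}"

section \<open>Smooth boundary\<close>

text \<open>Near each boundary point \<open>D\<close> is the region strictly above the graph, in some direction
  \<open>e\<close>, of a smooth function \<open>g\<close> of the component orthogonal to \<open>e\<close>. A smooth function on the
  hyperplane orthogonal to \<open>e\<close> is the same as the restriction of a smooth function on the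
  whole space.\<close>

definition smooth_boundary :: "'a::euclidean_space set \<Rightarrow> bool" where
  "smooth_boundary D \<longleftrightarrow>
     (\<forall>z\<in>frontier D. \<exists>r>0. \<exists>e g. norm e = 1 \<and> smooth_on UNIV g \<and>
        D \<inter> ball z r = {x \<in> ball z r. g (x - (x \<bullet> e) *\<^sub>R e) < x \<bullet> e})"

section \<open>Lebesgue and Sobolev spaces\<close>

text \<open>Elements of these spaces are represented by functions on the whole space of which only
  the values on \<open>D\<close>, up to null sets, are relevant.\<close>

definition Lp :: "real \<Rightarrow> 'a::euclidean_space set \<Rightarrow> ('a \<Rightarrow> 'b::euclidean_space) set" where
  "Lp p D = {u \<in> borel_measurable (lebesgue_on D).
     integrable (lebesgue_on D) (\<lambda>x. norm (u x) powr p)}"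

definition locally_integrable ::
    "'a::euclidean_space set \<Rightarrow> ('a \<Rightarrow> 'b::euclidean_space) \<Rightarrow> bool" where
  "locally_integrable D u \<longleftrightarrow> (\<forall>K. compact K \<and> K \<subseteq> D \<longrightarrow> integrable (lebesgue_on K) u)"

definition has_weak_grad ::
    "'a::euclidean_space set \<Rightarrow> ('a \<Rightarrow> real) \<Rightarrow> ('a \<Rightarrow> 'a) \<Rightarrow> bool" where
  "has_weak_grad D u g \<longleftrightarrow> locally_integrable D u \<and> locally_integrable D g \<and>
     (\<forall>v\<in>test_functions D.
        (LINT x|lebesgue_on D. u x *\<^sub>R grad v x) = - (LINT x|lebesgue_on D. v x *\<^sub>R g x))"

text \<open>The weak gradient is determined only up to a null set; a representative is chosen.\<close>

definition weak_grad :: "'a::euclidean_space set \<Rightarrow> ('a \<Rightarrow> real) \<Rightarrow> 'a \<Rightarrow> 'a" where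
  "weak_grad D u = (SOME g. has_weak_grad D u g)"

definition W12 :: "'a::euclidean_space set \<Rightarrow> ('a \<Rightarrow> real) set" where
  "W12 D = {u \<in> Lp 2 D. \<exists>g \<in> Lp 2 D. has_weak_grad D u g}"

definition W12_norm :: "'a::euclidean_space set \<Rightarrow> ('a \<Rightarrow> real) \<Rightarrow> real" where
  "W12_norm D u = sqrt ((LINT x|lebesgue_on D. (u x)\<^sup>2) +
     (LINT x|lebesgue_on D. (norm (weak_grad D u x))\<^sup>2))"

text \<open>The closure of \<open>C\<^sub>0\<^sup>\<infinity>(D)\<close> in \<open>W\<^sup>1\<^sup>,\<^sup>2(D)\<close>.\<close>

definition W12_0 :: "'a::euclidean_space set \<Rightarrow> ('a \<Rightarrow> real) set" where
  "W12_0 D = {u \<in> W12 D. \<exists>\<phi>. (\<forall>k::nat. \<phi> k \<in> test_functions D) \<and>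
     (\<lambda>k. W12_norm D (\<lambda>x. u x - \<phi> k x)) \<longlonglongrightarrow> 0}"

section \<open>The functional, its critical points, and the equation\<close>

definition Phi :: "'a::euclidean_space set \<Rightarrow> real \<Rightarrow> ('a \<Rightarrow> real) \<Rightarrow> real" where
  "Phi D p u = (LINT x|lebesgue_on D. (norm (weak_grad D u x))\<^sup>2) /
     (LINT x|lebesgue_on D. \<bar>u x\<bar> powr p) powr (2 / p)"

definition critical_point :: "'a::euclidean_space set \<Rightarrow> real \<Rightarrow> ('a \<Rightarrow> real) \<Rightarrow> bool" where
  "critical_point D p u \<longleftrightarrow> u \<in> Lp p D \<inter> W12_0 D \<and> \<not> (AE x in lebesgue_on D. u x = 0) \<and>
     (\<forall>v \<in> Lp p D \<inter> W12_0 D.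
        ((\<lambda>\<epsilon>. Phi D p (\<lambda>x. u x + \<epsilon> * v x)) has_real_derivative 0) (at 0))"

text \<open>Weak form of \<open>\<Delta>u + \<Lambda> u\<^sup>p\<^sup>-\<^sup>1 = 0\<close> in \<open>D\<close>, with \<open>u\<^sup>p\<^sup>-\<^sup>1\<close> read as \<open>\<bar>u\<bar>\<^sup>p\<^sup>-\<^sup>2 u\<close>, which is \<open>0\<close>
  where \<open>u = 0\<close>. Integrability is required explicitly because the integral of a
  non-integrable function is \<open>0\<close> by convention.\<close>

definition weak_solution ::
    "'a::euclidean_space set \<Rightarrow> real \<Rightarrow> real \<Rightarrow> ('a \<Rightarrow> real) \<Rightarrow> bool" where
  "weak_solution D p \<Lambda> u \<longleftrightarrow> (\<forall>v \<in> test_functions D.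
     integrable (lebesgue_on D)
       (\<lambda>x. - (weak_grad D u x \<bullet> grad v x) + \<Lambda> * (\<bar>u x\<bar> powr (p - 2) * u x) * v x) \<and>
     (LINT x|lebesgue_on D.
       - (weak_grad D u x \<bullet> grad v x) + \<Lambda> * (\<bar>u x\<bar> powr (p - 2) * u x) * v x) = 0)"

end

theory Submission
  imports Defs
begin

text \<open>Write \<open>E(t)\<close> for the Dirichlet energy of \<open>u + t v\<close>, a quadratic polynomial in \<open>t\<close>, and
  \<open>N(t)\<close> for the integral of \<open>\<bar>u + t v\<bar>\<^sup>p\<close>. If \<open>E(0) = 0\<close>, then the gradient of \<open>u\<close> vanishes and
  \<open>\<Lambda> = 0\<close> works. Otherwise \<open>N\<^sup>2\<^sup>/\<^sup>p = E / \<Phi>\<close> near \<open>0\<close>, so criticality forces \<open>N\<close> to be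
  differentiable at \<open>0\<close>, even for \<open>p = 1\<close>, where the integrand need not be. Its derivative can
  then be computed from symmetric difference quotients, and comparing it with \<open>E'(0)\<close> gives the
  weak equation with \<open>\<Lambda> = E(0) / N(0)\<close>. Expanding \<open>E\<close> requires the uniqueness of weak gradients,
  for which smooth bump functions approximating indicators of boxes are constructed from
  \<open>exp (- 1 / t)\<close>.\<close>

section \<open>Smooth bump functions\<close>

lemma frechet_derivative_eqI:
  "(f has_derivative f') (at x) \<Longrightarrow> frechet_derivative f (at x) = f'"
  by (rule frechet_derivative_at[symmetric])

text \<open>The successor clause speaks only of differentiability and of the derivatives, so the
  inclusion of the classes needs an induction; its base case is that differentiability implies
  continuity.\<close>

lemma Ck_on_SucD: "Ck_on S f (Suc k) \<Longrightarrow> Ck_on S f k"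
proof (induction k arbitrary: f)
  case 0
  then show ?case
    by (auto intro!: continuous_at_imp_continuous_on differentiable_imp_continuous_within)
qed auto

lemma Ck_on_const: "Ck_on S (\<lambda>x. c) k"
  by (induction k arbitrary: c) auto

lemma Ck_on_inner: "Ck_on S (\<lambda>x. x \<bullet> b) k"
proof (cases k)
  case (Suc m)
  have D: "((\<lambda>x. x \<bullet> b) has_derivative (\<lambda>v. v \<bullet> b)) (at x)" for x :: 'a
    by (auto intro!: derivative_eq_intros)
  then have "frechet_derivative (\<lambda>x. x \<bullet> b) (at x) = (\<lambda>v. v \<bullet> b)" for x
    by (rule frechet_derivative_eqI)
  with D Suc show ?thesis
    by (auto simp: Ck_on_const differentiable_def)
qed (auto intro: continuous_intros)

lemma Ck_on_add:
  "Ck_on UNIV f k \<Longrightarrow> Ck_on UNIV g k \<Longrightarrow> Ck_on UNIV (\<lambda>x. f x + g x) k"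
proof (induction k arbitrary: f g)
  case (Suc k)
  have "frechet_derivative (\<lambda>x. f x + g x) (at x) =
      (\<lambda>v. frechet_derivative f (at x) v + frechet_derivative g (at x) v)" for x
    by (intro frechet_derivative_eqI has_derivative_add) (use Suc.prems in \<open>auto simp: frechet_derivative_works\<close>)
  with Suc show ?case by auto
qed (auto intro: continuous_intros)

lemma has_derivative_mult_frechet:
  fixes f g :: "'a::euclidean_space \<Rightarrow> real"
  assumes "f differentiable (at x)" "g differentiable (at x)"
  shows "((\<lambda>x. f x * g x) has_derivative
    (\<lambda>v. f x * frechet_derivative g (at x) v + frechet_derivative f (at x) v * g x)) (at x)"
  using assms by (intro has_derivative_mult) (auto simp: frechet_derivative_works)

lemma Ck_on_mult:
  "Ck_on UNIV f k \<Longrightarrow> Ck_on UNIV g k \<Longrightarrow> Ck_on UNIV (\<lambda>x. f x * g x) k"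
proof (induction k arbitrary: f g)
  case (Suc k)
  then have eq: "frechet_derivative (\<lambda>x. f x * g x) (at x) =
      (\<lambda>v. f x * frechet_derivative g (at x) v + frechet_derivative f (at x) v * g x)" for x
    by (intro frechet_derivative_eqI has_derivative_mult_frechet) auto
  \<comment> \<open>In the product rule one factor stays undifferentiated, so both factors are also
    needed at the lower order \<open>k\<close>.\<close>
  have "Ck_on UNIV f k" "Ck_on UNIV g k"
    using Suc.prems by (blast intro: Ck_on_SucD)+
  then show ?case
    using Suc.prems by (auto simp: eq intro!: Ck_on_add Suc.IH)
qed (auto intro: continuous_intros)

lemma Ck_on_prod:
  "finite I \<Longrightarrow> (\<And>i. i \<in> I \<Longrightarrow> Ck_on UNIV (f i) k) \<Longrightarrow> Ck_on UNIV (\<lambda>x. \<Prod>i\<in>I. f i x) k"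
  by (induction I rule: finite_induct) (auto intro: Ck_on_const Ck_on_mult)

text \<open>The classical flat function is the case \<open>m = 0\<close>. Dividing by
  \<open>t ^ m\<close> gives a family whose derivatives are linear combinations of its own members,
  so smoothness can be proved for all \<open>m\<close> at once by induction on the order.\<close>

definition flat_exp :: "nat \<Rightarrow> real \<Rightarrow> real" where
  "flat_exp m t = (if t \<le> 0 then 0 else exp (- 1 / t) / t ^ m)"

text \<open>Substituting \<open>inverse t\<close> turns the right-hand limit into the fact that the
  exponential outgrows every power; to the left of \<open>0\<close> the function is
  constant.\<close>

lemma tendsto_flat_exp_0: "(flat_exp m \<longlongrightarrow> 0) (at 0)"
proof -
  have "((\<lambda>t::real. inverse t ^ m / exp (inverse t)) \<longlongrightarrow> 0) (at_right 0)"
    by (rule filterlim_compose[OF tendsto_power_div_exp_0 filterlim_inverse_at_top_right])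
  moreover have "eventually (\<lambda>t. inverse t ^ m / exp (inverse t) = flat_exp m t) (at_right 0)"
    unfolding eventually_at_right_field
    by (auto simp: flat_exp_def exp_minus field_simps intro!: exI[of _ 1])
  ultimately have "(flat_exp m \<longlongrightarrow> 0) (at_right 0)"
    by (rule Lim_transform_eventually)
  moreover have "(flat_exp m \<longlongrightarrow> 0) (at_left 0)"
    by (rule Lim_transform_eventually[OF tendsto_const])
      (auto simp: flat_exp_def eventually_at_left_field intro!: exI[of _ "-1"])
  ultimately show ?thesis
    by (simp add: filterlim_at_split)
qed

lemma has_real_derivative_flat_exp:
  "(flat_exp m has_real_derivative flat_exp (m + 2) t - m * flat_exp (Suc m) t) (at t)"
proof (cases t "0 :: real" rule: linorder_cases)
  case less
  have "((\<lambda>t. 0) has_real_derivative 0) (at t)"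
    by simp
  then have "(flat_exp m has_real_derivative 0) (at t)"
    by (rule has_field_derivative_transform_within_open[of _ _ _ "{..<0}"])
      (use less in \<open>auto simp: flat_exp_def\<close>)
  then show ?thesis using less by (simp add: flat_exp_def)
next
  case equal
  \<comment> \<open>At \<open>0\<close> the difference quotient of \<open>flat_exp m\<close> is
    \<open>flat_exp (Suc m)\<close>, whose limit is \<open>0\<close>.\<close>
  have "((\<lambda>h. (flat_exp m (0 + h) - flat_exp m 0) / h) \<longlongrightarrow> 0) (at 0)"
    by (rule Lim_transform_eventually[OF tendsto_flat_exp_0[of "Suc m"]])
      (auto simp: flat_exp_def field_simps intro!: always_eventually)
  then show ?thesis
    unfolding DERIV_def using equal by (simp add: flat_exp_def)
next
  case greater
  have "((\<lambda>t. exp (- 1 / t) / t ^ m) has_real_derivative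
      (exp (- 1 / t) * (1 / t\<^sup>2) * t ^ m - exp (- 1 / t) * (m * t ^ (m - 1))) / (t ^ m * t ^ m)) (at t)"
    using greater by (auto intro!: derivative_eq_intros simp: power2_eq_square)
  also have "(exp (- 1 / t) * (1 / t\<^sup>2) * t ^ m - exp (- 1 / t) * (m * t ^ (m - 1))) / (t ^ m * t ^ m)
      = flat_exp (m + 2) t - m * flat_exp (Suc m) t"
    using greater by (cases m) (auto simp: flat_exp_def field_simps power2_eq_square)
  finally show ?thesis
    by (rule has_field_derivative_transform_within_open[of _ _ _ "{0<..}"])
      (use greater in \<open>auto simp: flat_exp_def\<close>)
qed

lemma flat_exp_bounds: "0 \<le> flat_exp 0 t" "flat_exp 0 t \<le> 1"
  by (auto simp: flat_exp_def)

text \<open>The chain rule produces a derivative of \<open>f\<close> times members of the same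
  family composed with \<open>f\<close>; hence the induction on \<open>k\<close> with both
  \<open>f\<close> and \<open>m\<close> generalized.\<close>

lemma Ck_on_flat_exp: "Ck_on UNIV f k \<Longrightarrow> Ck_on UNIV (\<lambda>x. flat_exp m (f x)) k"
proof (induction k arbitrary: f m)
  case 0
  have "continuous_on UNIV (flat_exp m)"
    using has_real_derivative_flat_exp
    by (intro continuous_at_imp_continuous_on) (blast intro: DERIV_isCont)
  then show ?case
    using 0 by (auto intro: continuous_on_compose2)
next
  case (Suc k)
  have D: "((\<lambda>x. flat_exp m (f x)) has_derivative
      (\<lambda>v. frechet_derivative f (at x) v * (flat_exp (m + 2) (f x) + - m * flat_exp (Suc m) (f x)))) (at x)" for x
    using Suc.prems has_real_derivative_flat_exp[of m "f x"]
    by (intro DERIV_compose_FDERIV) (auto simp: frechet_derivative_works)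
  have "Ck_on UNIV f k"
    using Suc.prems by (rule Ck_on_SucD)
  then have "Ck_on UNIV (\<lambda>x. frechet_derivative f (at x) v *
      (flat_exp (m + 2) (f x) + - m * flat_exp (Suc m) (f x))) k" for v
    using Suc.prems by (intro Ck_on_add Ck_on_mult Ck_on_const Suc.IH) auto
  then show ?case
    using D unfolding Ck_on.simps frechet_derivative_eqI[OF D] differentiable_def by blast
qed

text \<open>A product of one-dimensional cut-offs, one for each face of the box. The factor
  \<open>c\<close> sets their steepness: as it grows, the bump tends to the indicator of the open
  box.\<close>

definition box_bump :: "'a::euclidean_space \<Rightarrow> 'a \<Rightarrow> real \<Rightarrow> 'a \<Rightarrow> real" where
  "box_bump a b c x =
    (\<Prod>i\<in>Basis. flat_exp 0 (c * (x \<bullet> i - a \<bullet> i)) * flat_exp 0 (c * (b \<bullet> i - x \<bullet> i)))"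

lemma box_bump_bounds: "0 \<le> box_bump a b c x" "box_bump a b c x \<le> 1"
  unfolding box_bump_def
  by (auto intro!: prod_nonneg prod_le_1 mult_le_one flat_exp_bounds mult_nonneg_nonneg)

lemma box_bump_eq_0:
  assumes "c > 0" "x \<notin> box a b" shows "box_bump a b c x = 0"
  using assms unfolding box_bump_def mem_box
  by (auto simp: flat_exp_def mult_le_0_iff not_less)

lemma smooth_on_box_bump: "smooth_on UNIV (box_bump a b c)"
proof -
  have "Ck_on UNIV (\<lambda>x. \<Prod>i\<in>Basis. flat_exp 0 (c * (x \<bullet> i + - (a \<bullet> i))) * flat_exp 0 (c * (b \<bullet> i + -1 * (x \<bullet> i)))) k" for k
    by (intro Ck_on_prod Ck_on_mult Ck_on_flat_exp Ck_on_add Ck_on_const Ck_on_inner) auto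
  then show ?thesis
    by (simp add: smooth_on_def box_bump_def[abs_def])
qed

lemma box_bump_in_test_functions:
  assumes "c > 0" "cbox a b \<subseteq> D" shows "box_bump a b c \<in> test_functions D"
proof -
  have "closure {x. box_bump a b c x \<noteq> 0} \<subseteq> cbox a b"
    using box_bump_eq_0[OF assms(1)] box_subset_cbox by (intro closure_minimal) blast+
  moreover have "compact (closure {x. box_bump a b c x \<noteq> 0})"
    using calculation by (meson bounded_cbox bounded_subset closed_closure compact_eq_bounded_closed)
  ultimately show ?thesis
    using assms smooth_on_box_bump by (auto simp: test_functions_def)
qed

text \<open>For \<open>t > 0\<close> the exponent \<open>- 1 / (Suc n * t)\<close> tends to
  \<open>0\<close>, so the values tend to \<open>1\<close>; for other \<open>t\<close> all values
  are \<open>0\<close>.\<close>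

lemma tendsto_flat_exp_indicator:
  "(\<lambda>n. flat_exp 0 (real (Suc n) * t)) \<longlonglongrightarrow> indicator {0<..} t"
proof (cases "t > 0")
  case True
  have "(\<lambda>n. exp (- (inverse (real (Suc n)) / t))) \<longlonglongrightarrow> exp (- (0 / t))"
    by (intro tendsto_intros LIMSEQ_inverse_real_of_nat) (use True in auto)
  moreover have "exp (- (inverse (real (Suc n)) / t)) = flat_exp 0 (real (Suc n) * t)" for n
  proof -
    have "real (Suc n) * t > 0" using True by simp
    then show ?thesis by (simp add: flat_exp_def divide_simps del: of_nat_Suc)
  qed
  ultimately show ?thesis
    using True by simp
qed (auto simp: flat_exp_def mult_le_0_iff)

lemma tendsto_box_bump: "(\<lambda>n. box_bump a b (real (Suc n)) x) \<longlonglongrightarrow> indicator (box a b) x"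
proof -
  have "(\<lambda>n. box_bump a b (real (Suc n)) x) \<longlonglongrightarrow>
      (\<Prod>i\<in>Basis. indicator {0<..} (x \<bullet> i - a \<bullet> i) * indicator {0<..} (b \<bullet> i - x \<bullet> i))"
    unfolding box_bump_def by (intro tendsto_intros tendsto_flat_exp_indicator)
  also have "(\<Prod>i\<in>Basis. indicator {0<..} (x \<bullet> i - a \<bullet> i) * indicator {0<..} (b \<bullet> i - x \<bullet> i))
      = (indicator (box a b) x :: real)"
    by (cases "x \<in> box a b") (auto simp: mem_box indicator_def)
  finally show ?thesis .
qed

section \<open>Integration by parts for test functions\<close>

lemma has_real_derivative_along_line:
  fixes f :: "'a::euclidean_space \<Rightarrow> real"
  assumes "f differentiable (at (x + t *\<^sub>R b))"
  shows "((\<lambda>t. f (x + t *\<^sub>R b)) has_real_derivative frechet_derivative f (at (x + t *\<^sub>R b)) b) (at t)"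
proof -
  have *: "((\<lambda>t. x + t *\<^sub>R b) has_derivative (\<lambda>s. s *\<^sub>R b)) (at t)"
    by (auto intro!: derivative_eq_intros)
  have "(f has_derivative frechet_derivative f (at (x + t *\<^sub>R b))) (at (x + t *\<^sub>R b))"
    using assms by (simp add: frechet_derivative_works)
  from has_derivative_compose[OF * this] show ?thesis
    unfolding has_field_derivative_def linear_cmul[OF linear_frechet_derivative[OF assms]]
    by (simp add: mult_commute_abs)
qed

lemma
  fixes f :: "'a::euclidean_space \<Rightarrow> real"
  assumes "x \<notin> closure {x. f x \<noteq> 0}"
  shows eq_0_outside_support: "f x = 0"
    and frechet_derivative_outside_support: "frechet_derivative f (at x) = (\<lambda>v. 0)"
proof -
  show "f x = 0"
    using assms closure_subset[of "{x. f x \<noteq> 0}"] by blast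
  have "0 = f y" if "y \<in> - closure {x. f x \<noteq> 0}" for y
    using that closure_subset[of "{x. f x \<noteq> 0}"] by force
  moreover have "((\<lambda>y. 0 :: real) has_derivative (\<lambda>v. 0)) (at x)"
    by (rule has_derivative_const)
  moreover have "open (- closure {x. f x \<noteq> 0})" "x \<in> - closure {x. f x \<noteq> 0}"
    using assms by (auto intro: open_Compl)
  ultimately have "(f has_derivative (\<lambda>v. 0)) (at x)"
    by (metis has_derivative_transform_within_open)
  then show "frechet_derivative f (at x) = (\<lambda>v. 0)"
    by (rule frechet_derivative_eqI)
qed

lemma bounded_range_if_compact_support:
  fixes f :: "'a::euclidean_space \<Rightarrow> 'b::euclidean_space"
  assumes "continuous_on UNIV f" "compact K" "\<And>x. x \<notin> K \<Longrightarrow> f x = 0"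
  obtains C where "\<And>x. norm (f x) \<le> C" "C \<ge> 0"
proof -
  have "bounded (f ` K)"
    using assms by (intro compact_imp_bounded compact_continuous_image) (auto intro: continuous_on_subset)
  then obtain C where C: "\<And>x. x \<in> K \<Longrightarrow> norm (f x) \<le> C"
    by (auto simp: bounded_iff)
  have "norm (f x) \<le> max C 0" for x
    using assms(3)[of x] C[of x] by (cases "x \<in> K") (auto simp: le_max_iff_disj)
  then show thesis
    by (rule that[of "max C 0"]) simp
qed

lemma integrable_lborel_compact_support:
  fixes f :: "'a::euclidean_space \<Rightarrow> 'b::euclidean_space"
  assumes "continuous_on UNIV f" "compact K" "\<And>x. x \<notin> K \<Longrightarrow> f x = 0"
  shows "integrable lborel f"
proof -
  have "set_integrable lborel K f"
    unfolding set_integrable_def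
    by (rule borel_integrable_compact) (use assms in \<open>auto intro: continuous_on_subset\<close>)
  also have "set_integrable lborel K f \<longleftrightarrow> integrable lborel f"
    unfolding set_integrable_def
    using assms(3) by (intro Bochner_Integration.integrable_cong refl) (auto simp: indicator_def)
  finally show ?thesis .
qed

lemma lborel_integral_translation:
  fixes f :: "'a::euclidean_space \<Rightarrow> 'b::euclidean_space"
  assumes [measurable]: "f \<in> borel_measurable borel"
  shows "(LINT x|lborel. f (x + c)) = (LINT x|lborel. f x)"
proof -
  have "(LINT x|lborel. f x) = (LINT x|distr lborel borel ((+) c). f x)"
    by (simp add: lborel_distr_plus)
  also have "\<dots> = (LINT x|lborel. f (c + x))"
    by (intro integral_distr) auto
  finally show ?thesis by (simp add: add.commute)
qed

text \<open>Difference quotients integrate to zero by translation invariance, and they converge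
  boundedly to the directional derivative.\<close>

lemma lborel_integral_frechet_derivative_eq_0:
  fixes w :: "'a::euclidean_space \<Rightarrow> real"
  assumes w: "Ck_on UNIV w 1" and supp: "compact (closure {x. w x \<noteq> 0})"
  shows "(LINT x|lborel. frechet_derivative w (at x) b) = 0"
proof -
  define K where "K = closure {x. w x \<noteq> 0}"
  define s where "s n = inverse (real (Suc n))" for n
  have s: "0 < s n" "s n \<le> 1" for n
    by (auto simp: s_def field_simps)
  have K: "compact K" "\<And>x. x \<notin> K \<Longrightarrow> w x = 0" "\<And>x v. x \<notin> K \<Longrightarrow> frechet_derivative w (at x) v = 0"
    unfolding K_def
    by (fact supp, erule eq_0_outside_support, simp only: frechet_derivative_outside_support not_False_eq_True)
  have diff: "w differentiable (at x)" for x
    using w by simp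
  have cont: "continuous_on UNIV w" "continuous_on UNIV (\<lambda>x. frechet_derivative w (at x) b)"
    using w Ck_on_SucD[of UNIV w 0] by auto
  then have [measurable]: "w \<in> borel_measurable borel"
      "(\<lambda>x. frechet_derivative w (at x) b) \<in> borel_measurable borel"
    by (auto intro: borel_measurable_continuous_onI)
  obtain C where C: "\<And>x. norm (frechet_derivative w (at x) b) \<le> C" "C \<ge> 0"
    using bounded_range_if_compact_support[OF cont(2) K(1) K(3)] by metis
  obtain R where R: "\<And>x. x \<in> K \<Longrightarrow> norm x \<le> R"
    using compact_imp_bounded[OF K(1)] by (auto simp: bounded_iff)
  define g where "g n x = (w (x + s n *\<^sub>R b) - w x) / s n" for n x
  have int_w: "integrable lborel w"
    by (rule integrable_lborel_compact_support[OF cont(1) K(1,2)])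
  have int_shift: "integrable lborel (\<lambda>x. w (x + c))" for c
  proof (rule integrable_lborel_compact_support)
    show "continuous_on UNIV (\<lambda>x. w (x + c))"
      by (rule continuous_on_compose2[OF cont(1)]) (auto intro!: continuous_intros)
    show "compact ((\<lambda>x. x - c) ` K)"
      using K(1) by (intro compact_continuous_image continuous_intros)
    show "w (x + c) = 0" if "x \<notin> (\<lambda>x. x - c) ` K" for x
      using that by (intro K(2)) (auto simp: image_iff)
  qed
  have "(LINT x|lborel. g n x) = 0" for n
    unfolding g_def using int_w int_shift lborel_integral_translation[of w "s n *\<^sub>R b"] by simp
  \<comment> \<open>The majorant is \<open>C\<close> on a ball that contains the support of
    \<open>w\<close> and all its translates by vectors no longer than \<open>b\<close>; since
    \<open>s n \<le> 1\<close>, every \<open>g n\<close> vanishes outside it.\<close>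
  moreover have "(\<lambda>n. LINT x|lborel. g n x) \<longlonglongrightarrow> (LINT x|lborel. frechet_derivative w (at x) b)"
  proof (rule integral_dominated_convergence[where w = "\<lambda>x. C * indicator (cball 0 (R + norm b)) x"])
    show "integrable lborel (\<lambda>x. C * indicator (cball 0 (R + norm b)) x :: real)"
      by (intro integrable_mult_right integrable_real_indicator) (simp_all add: emeasure_lborel_cball_finite flip: infinity_ennreal_def)
    show "AE x in lborel. (\<lambda>n. g n x) \<longlonglongrightarrow> frechet_derivative w (at x) b"
    proof (rule AE_I2)
      fix x
      have "((\<lambda>h. (w (x + (0 + h) *\<^sub>R b) - w (x + 0 *\<^sub>R b)) / h) \<longlongrightarrow> frechet_derivative w (at (x + 0 *\<^sub>R b)) b) (at 0)"
        using has_real_derivative_along_line[of w x 0 b, OF diff] unfolding DERIV_def .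
      moreover have "filterlim s (at 0) sequentially"
        unfolding s_def filterlim_at by (intro conjI LIMSEQ_inverse_real_of_nat always_eventually) simp
      ultimately have "(\<lambda>n. (w (x + (0 + s n) *\<^sub>R b) - w (x + 0 *\<^sub>R b)) / s n)
          \<longlonglongrightarrow> frechet_derivative w (at (x + 0 *\<^sub>R b)) b"
        by (rule filterlim_compose)
      then show "(\<lambda>n. g n x) \<longlonglongrightarrow> frechet_derivative w (at x) b"
        by (simp add: g_def)
    qed
    show "AE x in lborel. norm (g n x) \<le> C * indicator (cball 0 (R + norm b)) x" for n
    proof (rule AE_I2)
      fix x
      \<comment> \<open>Mean value inequality on the line through \<open>x\<close> in direction
        \<open>b\<close>, where the derivative is bounded by \<open>C\<close>.\<close>
      have "norm (w (x + s n *\<^sub>R b) - w (x + 0 *\<^sub>R b)) \<le> C * norm (s n - 0)"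
        by (rule field_differentiable_bound[where S = UNIV and f = "\<lambda>t. w (x + t *\<^sub>R b)"])
          (use C has_real_derivative_along_line[OF diff] in auto)
      then have bound: "norm (g n x) \<le> C"
        using s[of n] by (simp add: g_def field_simps)
      have "g n x = 0" if "x \<notin> cball 0 (R + norm b)"
      proof -
        have "norm (s n *\<^sub>R b) \<le> norm b"
          using s[of n] by (simp add: mult_left_le_one_le)
        moreover have "norm x \<le> norm (x + s n *\<^sub>R b) + norm (s n *\<^sub>R b)"
          using norm_triangle_ineq4[of "x + s n *\<^sub>R b" "s n *\<^sub>R b"] by simp
        ultimately have "x + s n *\<^sub>R b \<notin> K" "x \<notin> K"
          using that R[of "x + s n *\<^sub>R b"] R[of x] norm_ge_zero[of b] by (auto simp: not_le)
        then show ?thesis by (simp add: g_def K)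
      qed
      with bound show "norm (g n x) \<le> C * indicator (cball 0 (R + norm b)) x"
        by (auto simp: indicator_def)
    qed
  qed (auto simp: g_def)
  ultimately show ?thesis
    by (simp add: LIMSEQ_const_iff)
qed

section \<open>Gradients, supports and integrability for test functions\<close>

lemma inner_grad: "b \<in> Basis \<Longrightarrow> grad f x \<bullet> b = frechet_derivative f (at x) b"
  by (simp add: grad_def)

lemma
  assumes "f \<in> test_functions D"
  shows test_function_differentiable: "f differentiable (at x)"
    and test_function_Ck: "Ck_on UNIV f k"
    and continuous_on_test_function: "continuous_on UNIV f"
    and continuous_on_grad: "continuous_on UNIV (grad f)"
proof -
  have Ck: "Ck_on UNIV f k" for k
    using assms by (simp add: test_functions_def smooth_on_def)
  from Ck show "Ck_on UNIV f k" .
  from Ck[of 0] Ck[of 1] show "f differentiable (at x)" "continuous_on UNIV f"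
    by auto
  from Ck[of 1] show "continuous_on UNIV (grad f)"
    unfolding grad_def[abs_def] by (auto intro!: continuous_intros)
qed

lemma test_function_support:
  assumes "f \<in> test_functions D"
  obtains K where "compact K" "K \<subseteq> D" "\<And>x. x \<notin> K \<Longrightarrow> f x = 0" "\<And>x. x \<notin> K \<Longrightarrow> grad f x = 0"
proof
  show "compact (closure {x. f x \<noteq> 0})" "closure {x. f x \<noteq> 0} \<subseteq> D"
    using assms by (simp_all add: test_functions_def)
  show "f x = 0" if "x \<notin> closure {x. f x \<noteq> 0}" for x
    using that by (rule eq_0_outside_support)
  show "grad f x = 0" if "x \<notin> closure {x. f x \<noteq> 0}" for x
    using frechet_derivative_outside_support[OF that] by (simp add: grad_def)
qed

text \<open>Moves integrals of functions supported in \<open>D\<close> to the Borel measure on the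
  whole space, where translation invariance was exploited.\<close>

lemma integral_lebesgue_on_eq_lborel:
  fixes f :: "'a::euclidean_space \<Rightarrow> 'b::euclidean_space"
  assumes "D \<in> sets lebesgue" "continuous_on UNIV f" "\<And>x. x \<notin> D \<Longrightarrow> f x = 0"
  shows "(LINT x|lebesgue_on D. f x) = (LINT x|lborel. f x)"
proof -
  have "(LINT x|lebesgue_on D. f x) = (LINT x|lebesgue. indicator D x *\<^sub>R f x)"
    using assms(1) by (subst integral_restrict_space) auto
  also have "\<dots> = (LINT x|lebesgue. f x)"
    using assms(3) by (intro Bochner_Integration.integral_cong refl) (auto simp: indicator_def)
  also have "\<dots> = (LINT x|lborel. f x)"
    using assms(2) by (intro integral_completion) (simp add: borel_measurable_continuous_onI)
  finally show ?thesis .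
qed

lemma integrable_lebesgue_on_compact_support:
  fixes f :: "'a::euclidean_space \<Rightarrow> 'b::euclidean_space"
  assumes "D \<in> sets lebesgue" "continuous_on UNIV f" "compact K" "\<And>x. x \<notin> K \<Longrightarrow> f x = 0"
  shows "integrable (lebesgue_on D) f"
proof -
  have "integrable lebesgue f"
    using integrable_lborel_compact_support[OF assms(2,3,4)]
    using borel_measurable_continuous_onI[OF assms(2)] by (simp add: integrable_completion)
  then have "integrable lebesgue (\<lambda>x. indicator D x *\<^sub>R f x)"
    by (rule integrable_mult_indicator[OF assms(1)])
  then show ?thesis
    using assms(1) by (subst integrable_restrict_space) auto
qed

text \<open>In each coordinate this is the product rule: \<open>f * v\<close> has compact support,
  so its partial derivatives integrate to zero.\<close>

lemma integral_by_parts_test_functions: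
  assumes f: "f \<in> test_functions D" and v: "v \<in> test_functions D"
  shows "(LINT x|lborel. f x *\<^sub>R grad v x) = - (LINT x|lborel. v x *\<^sub>R grad f x)"
proof (rule euclidean_eqI)
  fix b :: 'a assume b: "b \<in> Basis"
  obtain K where K: "compact K" "K \<subseteq> D" "\<And>x. x \<notin> K \<Longrightarrow> f x = 0" "\<And>x. x \<notin> K \<Longrightarrow> grad f x = 0"
    using test_function_support[OF f] by metis
  note cont = continuous_on_test_function[OF f] continuous_on_grad[OF f]
    continuous_on_test_function[OF v] continuous_on_grad[OF v]
  have int: "integrable lborel (\<lambda>x. f x *\<^sub>R grad v x)" "integrable lborel (\<lambda>x. v x *\<^sub>R grad f x)"
    using K cont by (auto intro!: integrable_lborel_compact_support[where K = K] continuous_on_scaleR)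
  have "closure {x. f x * v x \<noteq> 0} \<subseteq> K"
    using K by (intro closure_minimal) (auto simp: compact_imp_closed)
  then have "compact (closure {x. f x * v x \<noteq> 0})"
    using K(1) by (meson closed_closure compact_imp_bounded bounded_subset compact_eq_bounded_closed)
  then have "(LINT x|lborel. frechet_derivative (\<lambda>x. f x * v x) (at x) b) = 0"
    by (intro lborel_integral_frechet_derivative_eq_0 Ck_on_mult test_function_Ck[OF f] test_function_Ck[OF v])
  moreover have "frechet_derivative (\<lambda>x. f x * v x) (at x) b = (f x *\<^sub>R grad v x + v x *\<^sub>R grad f x) \<bullet> b" for x
    using has_derivative_mult_frechet[OF test_function_differentiable[OF f] test_function_differentiable[OF v], of x] b
    by (simp add: frechet_derivative_eqI inner_grad inner_add_left)
  ultimately have "(LINT x|lborel. f x *\<^sub>R grad v x + v x *\<^sub>R grad f x) \<bullet> b = 0"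
    using int by (subst integral_inner_left[symmetric]) auto
  then show "(LINT x|lborel. f x *\<^sub>R grad v x) \<bullet> b = (- (LINT x|lborel. v x *\<^sub>R grad f x)) \<bullet> b"
    using int by (simp add: inner_add_left)
qed

text \<open>The continuous factor is bounded and vanishes off a compact \<open>K\<close> on which
  \<open>h\<close> is integrable, so a multiple of \<open>norm (h x)\<close> on \<open>K\<close>
  dominates. The abstract \<open>B\<close> covers scalar multiplication in either order and the
  inner product at once.\<close>

lemma integrable_bilinear_compact_support:
  fixes B :: "'c::euclidean_space \<Rightarrow> 'b::euclidean_space \<Rightarrow> 'd::euclidean_space"
    and w :: "'a::euclidean_space \<Rightarrow> 'c"
  assumes B: "bounded_bilinear B" and D: "D \<in> sets lebesgue" and h: "locally_integrable D h"
    and w: "continuous_on UNIV w" "compact K" "K \<subseteq> D" "\<And>x. x \<notin> K \<Longrightarrow> w x = 0"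
  shows "integrable (lebesgue_on D) (\<lambda>x. B (w x) (h x))"
proof -
  interpret bounded_bilinear B by fact
  obtain C where C: "\<And>x. norm (w x) \<le> C" "C \<ge> 0"
    using bounded_range_if_compact_support[OF w(1,2,4)] by metis
  obtain L where L: "\<And>a b. norm (B a b) \<le> norm a * norm b * L" "L > 0"
    using pos_bounded by metis
  have "integrable (lebesgue_on K) h"
    using h w by (simp add: locally_integrable_def)
  then have hK: "integrable lebesgue (\<lambda>x. indicator K x *\<^sub>R h x)"
    using w(2) by (subst (asm) integrable_restrict_space) (auto simp: lmeasurable_compact fmeasurableD)
  have "integrable lebesgue (\<lambda>x. B (w x) (indicator K x *\<^sub>R h x))"
  proof (rule Bochner_Integration.integrable_bound)
    show "integrable lebesgue (\<lambda>x. C * L * norm (indicator K x *\<^sub>R h x))"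
      by (rule integrable_mult_right, rule integrable_norm, rule hK)
    have "w \<in> borel_measurable lebesgue"
      using w(1) by (simp add: borel_measurable_continuous_onI measurable_completion)
    then show "(\<lambda>x. B (w x) (indicator K x *\<^sub>R h x)) \<in> borel_measurable lebesgue"
      by (rule borel_measurable_continuous_Pair[where H = B, OF _ borel_measurable_integrable[OF hK]])
        (intro continuous_on continuous_on_fst continuous_on_snd continuous_on_id)
    show "AE x in lebesgue. norm (B (w x) (indicator K x *\<^sub>R h x)) \<le> norm (C * L * norm (indicator K x *\<^sub>R h x))"
    proof (rule AE_I2)
      fix x
      have "norm (B (w x) (indicator K x *\<^sub>R h x)) \<le> norm (w x) * norm (indicator K x *\<^sub>R h x) * L"
        by (rule L)
      also have "\<dots> \<le> C * norm (indicator K x *\<^sub>R h x) * L"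
        using C L by (intro mult_right_mono) auto
      finally show "norm (B (w x) (indicator K x *\<^sub>R h x)) \<le> norm (C * L * norm (indicator K x *\<^sub>R h x))"
        using C L by (simp add: ac_simps abs_mult)
    qed
  qed
  also have "(\<lambda>x. B (w x) (indicator K x *\<^sub>R h x)) = (\<lambda>x. indicator D x *\<^sub>R B (w x) (h x))"
    using w(3,4) by (auto simp: fun_eq_iff indicator_def zero_left zero_right)
  finally show ?thesis
    using D by (subst integrable_restrict_space) auto
qed

lemma
  assumes D: "D \<in> sets lebesgue" and v: "v \<in> test_functions D"
  shows integrable_test_function_scaleR:
      "locally_integrable D h \<Longrightarrow> integrable (lebesgue_on D) (\<lambda>x. v x *\<^sub>R h x)"
    and integrable_scaleR_grad:
      "locally_integrable D u \<Longrightarrow> integrable (lebesgue_on D) (\<lambda>x. u x *\<^sub>R grad v x)"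
    and integrable_inner_grad:
      "locally_integrable D g \<Longrightarrow> integrable (lebesgue_on D) (\<lambda>x. g x \<bullet> grad v x)"
proof -
  obtain K where K: "compact K" "K \<subseteq> D" "\<And>x. x \<notin> K \<Longrightarrow> v x = 0" "\<And>x. x \<notin> K \<Longrightarrow> grad v x = 0"
    using test_function_support[OF v] by metis
  note cont = continuous_on_test_function[OF v] continuous_on_grad[OF v]
  show "integrable (lebesgue_on D) (\<lambda>x. v x *\<^sub>R h x)" if "locally_integrable D h"
    by (rule integrable_bilinear_compact_support[OF bounded_bilinear_scaleR D that cont(1) K(1,2,3)])
  show "integrable (lebesgue_on D) (\<lambda>x. u x *\<^sub>R grad v x)" if "locally_integrable D u"
    by (rule integrable_bilinear_compact_support[OF bounded_bilinear.flip[OF bounded_bilinear_scaleR] D that cont(2) K(1,2,4)])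
  show "integrable (lebesgue_on D) (\<lambda>x. g x \<bullet> grad v x)" if "locally_integrable D g"
    by (rule integrable_bilinear_compact_support[OF bounded_bilinear.flip[OF bounded_bilinear_inner] D that cont(2) K(1,2,4)])
qed

section \<open>The fundamental lemma of the calculus of variations\<close>

text \<open>Box bumps are admissible test functions and converge boundedly to the indicator of the
  open box, so dominated convergence carries the orthogonality over to that indicator.\<close>

lemma integral_box_eq_0_if_orthogonal_to_test_functions:
  fixes h :: "'a::euclidean_space \<Rightarrow> 'b::euclidean_space"
  assumes D: "D \<in> sets lebesgue" and h: "locally_integrable D h"
    and orth: "\<And>v. v \<in> test_functions D \<Longrightarrow> (LINT x|lebesgue_on D. v x *\<^sub>R h x) = 0"
    and ab: "cbox a b \<subseteq> D"
  shows "(LINT x|lebesgue. indicator (box a b) x *\<^sub>R h x) = 0"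
proof -
  have "integrable (lebesgue_on (cbox a b)) h"
    using h ab by (simp add: locally_integrable_def)
  then have int: "integrable lebesgue (\<lambda>x. indicator (cbox a b) x *\<^sub>R h x)"
    by (subst (asm) integrable_restrict_space) auto
  have bump: "box_bump a b (real (Suc n)) \<in> test_functions D" for n
    by (rule box_bump_in_test_functions[OF _ ab]) simp
  \<comment> \<open>Trades the cut-off to \<open>D\<close> for one to the closed box, where
    \<open>h\<close> is known to be integrable; the bump vanishes off the open box.\<close>
  have eq: "indicator D x *\<^sub>R (box_bump a b (real (Suc n)) x *\<^sub>R h x)
      = box_bump a b (real (Suc n)) x *\<^sub>R (indicator (cbox a b) x *\<^sub>R h x)" for n x
  proof (cases "x \<in> box a b")
    case True
    then have "x \<in> D" "x \<in> cbox a b"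
      using ab box_subset_cbox[of a b] by auto
    then show ?thesis by simp
  next
    case False
    then have "box_bump a b (real (Suc n)) x = 0"
      by (intro box_bump_eq_0) simp_all
    then show ?thesis by simp
  qed
  have "(LINT x|lebesgue. box_bump a b (real (Suc n)) x *\<^sub>R (indicator (cbox a b) x *\<^sub>R h x)) = 0" for n
    using orth[OF bump] D by (subst (asm) integral_restrict_space) (simp_all only: eq, simp)
  moreover have "(\<lambda>n. LINT x|lebesgue. box_bump a b (real (Suc n)) x *\<^sub>R (indicator (cbox a b) x *\<^sub>R h x))
      \<longlonglongrightarrow> (LINT x|lebesgue. indicator (box a b) x *\<^sub>R (indicator (cbox a b) x *\<^sub>R h x))"
  proof (rule integral_dominated_convergence)
    show "integrable lebesgue (\<lambda>x. norm (indicator (cbox a b) x *\<^sub>R h x))"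
      using int by (rule integrable_norm)
    show "(\<lambda>x. indicator (box a b) x *\<^sub>R (indicator (cbox a b) x *\<^sub>R h x)) \<in> borel_measurable lebesgue"
      by (intro borel_measurable_scaleR borel_measurable_indicator borel_measurable_integrable[OF int]) auto
    have "box_bump a b (real (Suc n)) \<in> borel_measurable lebesgue" for n
      using borel_measurable_continuous_onI[OF continuous_on_test_function[OF bump]]
      by (simp add: measurable_completion)
    then show "(\<lambda>x. box_bump a b (real (Suc n)) x *\<^sub>R (indicator (cbox a b) x *\<^sub>R h x)) \<in> borel_measurable lebesgue" for n
      by (intro borel_measurable_scaleR borel_measurable_integrable[OF int])
    show "AE x in lebesgue. (\<lambda>n. box_bump a b (real (Suc n)) x *\<^sub>R (indicator (cbox a b) x *\<^sub>R h x))
        \<longlonglongrightarrow> indicator (box a b) x *\<^sub>R (indicator (cbox a b) x *\<^sub>R h x)"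
      by (intro AE_I2 tendsto_scaleR tendsto_box_bump tendsto_const)
    show "AE x in lebesgue. norm (box_bump a b (real (Suc n)) x *\<^sub>R (indicator (cbox a b) x *\<^sub>R h x))
        \<le> norm (indicator (cbox a b) x *\<^sub>R h x)" for n
      using box_bump_bounds[of a b "real (Suc n)"]
      by (intro AE_I2) (simp only: norm_scaleR[of "box_bump a b (real (Suc n)) _"] abs_of_nonneg mult_left_le_one_le norm_ge_zero)
  qed
  ultimately have "(LINT x|lebesgue. indicator (box a b) x *\<^sub>R (indicator (cbox a b) x *\<^sub>R h x)) = 0"
    by (simp add: LIMSEQ_const_iff)
  also have "(\<lambda>x. indicator (box a b) x *\<^sub>R (indicator (cbox a b) x *\<^sub>R h x)) = (\<lambda>x. indicator (box a b) x *\<^sub>R h x)"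
    using box_subset_cbox[of a b] by (auto simp: indicator_def fun_eq_iff)
  finally show ?thesis .
qed

text \<open>Required for the uniqueness of Banach-valued densities; a countable exhaustion for
  \<open>lborel\<close> keeps its measures in the completion.\<close>

lemma sigma_finite_lebesgue: "sigma_finite_measure (lebesgue :: 'a::euclidean_space measure)"
proof
  obtain A :: "'a set set" where A: "countable A" "A \<subseteq> sets lborel" "\<Union>A = space lborel" "\<forall>a\<in>A. emeasure lborel a \<noteq> \<infinity>"
    using lborel.sigma_finite_countable by metis
  moreover have "emeasure lebesgue a = emeasure lborel a" if "a \<in> A" for a
    using A(2) that by (subst emeasure_completion) (auto intro: sets_completionI_sets)
  ultimately show "\<exists>A::'a set set. countable A \<and> A \<subseteq> sets lebesgue \<and> \<Union>A = space lebesgue \<and> (\<forall>a\<in>A. emeasure lebesgue a \<noteq> \<infinity>)"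
    by (intro exI[of _ A]) (auto intro: sets_completionI_sets)
qed

text \<open>Dynkin argument: open boxes are stable under intersection and generate the Borel sets,
  and the sets over which \<open>f\<close> integrates to zero are closed under disjoint countable
  unions and, as the total integral is zero, under complements.\<close>

lemma AE_eq_0_if_box_integrals_eq_0:
  fixes f :: "'a::euclidean_space \<Rightarrow> 'b::euclidean_space"
  assumes f: "integrable lebesgue f"
    and box: "\<And>a b. (LINT x|lebesgue. indicator (box a b) x *\<^sub>R f x) = 0"
    and total: "(LINT x|lebesgue. f x) = 0"
  shows "AE x in lebesgue. f x = 0"
proof -
  have int: "integrable lebesgue (\<lambda>x. indicator A x *\<^sub>R f x)" if "A \<in> sets lebesgue" for A
    using that f by (rule integrable_mult_indicator)
  have borel: "(LINT x|lebesgue. indicator A x *\<^sub>R f x) = 0" if "A \<in> sets borel" for A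
  proof -
    have sets: "B \<in> sets lebesgue" if "B \<in> sigma_sets UNIV (range (\<lambda>(a, b). box a b))" for B :: "'a set"
      using that by (intro sets_completionI_sets) (simp add: borel_eq_box)
    have "Int_stable (range (\<lambda>(a, b). box a b :: 'a set))"
      by (auto simp: Int_stable_def box_Int_box)
    moreover have "range (\<lambda>(a, b). box a b :: 'a set) \<subseteq> Pow UNIV"
      by auto
    moreover have "A \<in> sigma_sets UNIV (range (\<lambda>(a, b). box a b))"
      using that unfolding borel_eq_box by simp
    ultimately show ?thesis
    proof (induction rule: sigma_sets_induct_disjoint)
      case (basic A)
      then show ?case using box by auto
    next
      case empty
      show ?case by simp
    next
      case (compl A)
      have "(LINT x|lebesgue. indicator (UNIV - A) x *\<^sub>R f x) = (LINT x|lebesgue. f x - indicator A x *\<^sub>R f x)"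
        by (intro Bochner_Integration.integral_cong refl) (simp add: indicator_def)
      also have "\<dots> = 0"
        using f int[OF sets[OF compl(1)]] compl(2) total by (subst Bochner_Integration.integral_diff) auto
      finally show ?case .
    next
      case (union A)
      have "(LINT x:(\<Union>i. A i)|lebesgue. f x) = (\<Sum>i. (LINT x:(A i)|lebesgue. f x))"
      proof (rule lebesgue_integral_countable_add)
        show "A i \<in> sets lebesgue" for i
          using union(2) by (intro sets) auto
        then show "set_integrable lebesgue (\<Union>i. A i) f"
          unfolding set_integrable_def by (intro int sets.countable_UN) auto
        show "A i \<inter> A j = {}" if "i \<noteq> j" for i j
          using union(1) that by (auto simp: disjoint_family_on_def)
      qed
      then show ?case
        unfolding set_lebesgue_integral_def using union(3) by simp
    qed
  qed
  \<comment> \<open>A Lebesgue set is a Borel set up to a null set, so the integrals vanish over all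
    Lebesgue sets; uniqueness of densities then compares \<open>f\<close> with
    \<open>0\<close>.\<close>
  have "(LINT x:A|lebesgue. f x) = (LINT x:A|lebesgue. 0)" if A_sets: "A \<in> sets lebesgue" for A
  proof -
    obtain B N where B: "B \<in> sets borel" and N: "negligible N" and A: "B \<union> N = A"
      by (rule sets_lebesgue_almost_borel[OF A_sets])
    have "AE x in lebesgue. x \<notin> N"
      using N unfolding negligible_iff_null_sets by (rule AE_not_in)
    then have "AE x in lebesgue. indicator A x *\<^sub>R f x = indicator B x *\<^sub>R f x"
      by eventually_elim (auto simp: A[symmetric] indicator_def)
    moreover have "B \<in> sets lebesgue"
      using B by (intro sets_completionI_sets) simp
    ultimately have "(LINT x|lebesgue. indicator A x *\<^sub>R f x) = (LINT x|lebesgue. indicator B x *\<^sub>R f x)"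
      using int[OF A_sets] int[of B] by (intro integral_cong_AE borel_measurable_integrable)
    then show ?thesis
      using borel[OF B] by (simp add: set_lebesgue_integral_def)
  qed
  then show ?thesis
    using sigma_finite_measure.density_unique_banach[OF sigma_finite_lebesgue f, of "\<lambda>_. 0"] by simp
qed

text \<open>An open set is a countable union of closed boxes with rational corners, so it suffices
  that \<open>h\<close> vanishes almost everywhere on each closed box inside
  \<open>D\<close>.\<close>

lemma fundamental_lemma_calculus_of_variations:
  fixes h :: "'a::euclidean_space \<Rightarrow> 'b::euclidean_space"
  assumes D: "open D" and h: "locally_integrable D h"
    and orth: "\<And>v. v \<in> test_functions D \<Longrightarrow> (LINT x|lebesgue_on D. v x *\<^sub>R h x) = 0"
  shows "AE x in lebesgue_on D. h x = 0"
proof -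
  have DL: "D \<in> sets lebesgue"
    using D by (intro sets_completionI_sets) simp
  have AE_box: "AE x in lebesgue. x \<in> cbox a b \<longrightarrow> h x = 0" if ab: "cbox a b \<subseteq> D" for a b
  proof -
    have "integrable (lebesgue_on (cbox a b)) h"
      using h ab by (simp add: locally_integrable_def)
    then have "integrable lebesgue (\<lambda>x. indicator (cbox a b) x *\<^sub>R h x)"
      by (subst (asm) integrable_restrict_space) auto
    then have "integrable lebesgue (\<lambda>x. indicator (box a b) x *\<^sub>R (indicator (cbox a b) x *\<^sub>R h x))"
      by (rule integrable_mult_indicator[rotated]) simp
    also have "(\<lambda>x. indicator (box a b) x *\<^sub>R (indicator (cbox a b) x *\<^sub>R h x)) = (\<lambda>x. indicator (box a b) x *\<^sub>R h x)"
      using box_subset_cbox[of a b] by (auto simp: indicator_def fun_eq_iff)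
    finally have int: "integrable lebesgue (\<lambda>x. indicator (box a b) x *\<^sub>R h x)" .
    \<comment> \<open>Boxes intersect in boxes, so restricting \<open>h\<close> to
      \<open>box a b\<close> leaves only integrals of \<open>h\<close> over boxes inside
      \<open>D\<close>.\<close>
    have "(LINT x|lebesgue. indicator (box c d) x *\<^sub>R (indicator (box a b) x *\<^sub>R h x)) = 0" for c d
    proof -
      obtain e f where ef: "box c d \<inter> box a b = box e f" "cbox c d \<inter> cbox a b = cbox e f"
        using box_Int_box Int_interval by blast
      have "(\<lambda>x. indicator (box c d) x *\<^sub>R (indicator (box a b) x *\<^sub>R h x)) = (\<lambda>x. indicator (box e f) x *\<^sub>R h x)"
        by (auto simp: ef(1)[symmetric] indicator_def fun_eq_iff)
      moreover have "cbox e f \<subseteq> D"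
        using ab ef by blast
      ultimately show ?thesis
        using integral_box_eq_0_if_orthogonal_to_test_functions[OF DL h orth] by simp
    qed
    then have "AE x in lebesgue. indicator (box a b) x *\<^sub>R h x = 0"
      using integral_box_eq_0_if_orthogonal_to_test_functions[OF DL h orth ab]
      by (intro AE_eq_0_if_box_integrals_eq_0[OF int])
    \<comment> \<open>The boundary of a box is a null set, so the conclusion passes from the open to
      the closed box.\<close>
    moreover have "AE x in lebesgue. x \<notin> cbox a b - box a b"
      by (rule AE_not_in) (simp only: negligible_frontier_interval flip: negligible_iff_null_sets)
    ultimately show ?thesis
      by eventually_elim (auto simp: indicator_def)
  qed
  let ?a = "\<lambda>f :: 'a \<Rightarrow> real \<times> real. \<Sum>i\<in>Basis. fst (f i) *\<^sub>R i"
  let ?b = "\<lambda>f :: 'a \<Rightarrow> real \<times> real. \<Sum>i\<in>Basis. snd (f i) *\<^sub>R i"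
  define I where "I = {f \<in> (Basis :: 'a set) \<rightarrow>\<^sub>E \<rat> \<times> \<rat>. cbox (?a f) (?b f) \<subseteq> D}"
  have "countable ((Basis :: 'a set) \<rightarrow>\<^sub>E \<rat> \<times> (\<rat> :: real set))"
    by (intro countable_PiE countable_SIGMA countable_rat) simp_all
  then have "countable I"
    by (rule countable_subset[rotated]) (auto simp: I_def)
  have cover: "D = (\<Union>f\<in>I. cbox (?a f) (?b f))"
    unfolding I_def by (rule open_UNION_cbox[OF D])
  have "AE x in lebesgue. \<forall>f\<in>I. x \<in> cbox (?a f) (?b f) \<longrightarrow> h x = 0"
  proof (subst AE_ball_countable[OF \<open>countable I\<close>], intro ballI AE_box)
    show "cbox (?a f) (?b f) \<subseteq> D" if "f \<in> I" for f
      using that by (simp add: I_def)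
  qed
  then have "AE x in lebesgue. x \<in> D \<longrightarrow> h x = 0"
    by eventually_elim (use cover in blast)
  then show ?thesis
    using DL by (subst AE_restrict_space_iff) auto
qed

section \<open>Weak gradients\<close>

text \<open>The difference of two weak gradients is orthogonal to every test function, so the
  fundamental lemma applies to it.\<close>

lemma has_weak_grad_unique:
  assumes D: "open D" and g: "has_weak_grad D u g" and g': "has_weak_grad D u g'"
  shows "AE x in lebesgue_on D. g x = g' x"
proof -
  have DL: "D \<in> sets lebesgue"
    using D by (intro sets_completionI_sets) simp
  have loc: "locally_integrable D g" "locally_integrable D g'"
    using g g' by (auto simp: has_weak_grad_def)
  have "AE x in lebesgue_on D. g x - g' x = 0"
  proof (rule fundamental_lemma_calculus_of_variations[OF D])
    show "locally_integrable D (\<lambda>x. g x - g' x)"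
      using loc by (auto simp: locally_integrable_def)
    fix v assume v: "v \<in> test_functions D"
    then have "(LINT x|lebesgue_on D. v x *\<^sub>R g x) = (LINT x|lebesgue_on D. v x *\<^sub>R g' x)"
      using g g' by (simp add: has_weak_grad_def)
    then show "(LINT x|lebesgue_on D. v x *\<^sub>R (g x - g' x)) = 0"
      using integrable_test_function_scaleR[OF DL v loc(1)] integrable_test_function_scaleR[OF DL v loc(2)]
      by (simp add: scaleR_diff_right)
  qed
  then show ?thesis by simp
qed

lemma weak_grad_works: "has_weak_grad D u g \<Longrightarrow> has_weak_grad D u (weak_grad D u)"
  unfolding weak_grad_def by (rule someI[of "has_weak_grad D u"])

lemma AE_weak_grad_eq:
  "open D \<Longrightarrow> has_weak_grad D u g \<Longrightarrow> AE x in lebesgue_on D. weak_grad D u x = g x"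
  by (rule has_weak_grad_unique[OF _ weak_grad_works])

lemma locally_integrable_add_scaleR:
  "locally_integrable D f \<Longrightarrow> locally_integrable D g \<Longrightarrow> locally_integrable D (\<lambda>x. f x + c *\<^sub>R g x)"
  unfolding locally_integrable_def by (intro allI impI Bochner_Integration.integrable_add integrable_scaleR_right) auto

lemma has_weak_grad_add_mult:
  assumes D: "D \<in> sets lebesgue" and u: "has_weak_grad D u g" and v: "has_weak_grad D v h"
  shows "has_weak_grad D (\<lambda>x. u x + c * v x) (\<lambda>x. g x + c *\<^sub>R h x)"
proof -
  have loc: "locally_integrable D u" "locally_integrable D g" "locally_integrable D v" "locally_integrable D h"
    using u v by (auto simp: has_weak_grad_def)
  have "(LINT x|lebesgue_on D. (u x + c * v x) *\<^sub>R grad w x) = - (LINT x|lebesgue_on D. w x *\<^sub>R (g x + c *\<^sub>R h x))"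
    if w: "w \<in> test_functions D" for w
  proof -
    note int = integrable_scaleR_grad[OF D w loc(1)] integrable_scaleR_grad[OF D w loc(3)]
      integrable_test_function_scaleR[OF D w loc(2)] integrable_test_function_scaleR[OF D w loc(4)]
    have "(LINT x|lebesgue_on D. (u x + c * v x) *\<^sub>R grad w x)
        = (LINT x|lebesgue_on D. u x *\<^sub>R grad w x + c *\<^sub>R (v x *\<^sub>R grad w x))"
      by (simp add: scaleR_add_left)
    also have "\<dots> = (LINT x|lebesgue_on D. u x *\<^sub>R grad w x) + c *\<^sub>R (LINT x|lebesgue_on D. v x *\<^sub>R grad w x)"
      by (simp only: Bochner_Integration.integral_add[OF int(1) integrable_scaleR_right[OF int(2)]] integral_scaleR_right)
    also have "\<dots> = - ((LINT x|lebesgue_on D. w x *\<^sub>R g x) + c *\<^sub>R (LINT x|lebesgue_on D. w x *\<^sub>R h x))"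
      using u v w by (simp add: has_weak_grad_def)
    also have "\<dots> = - (LINT x|lebesgue_on D. w x *\<^sub>R g x + c *\<^sub>R (w x *\<^sub>R h x))"
      by (simp only: Bochner_Integration.integral_add[OF int(3) integrable_scaleR_right[OF int(4)]] integral_scaleR_right)
    also have "(\<lambda>x. w x *\<^sub>R g x + c *\<^sub>R (w x *\<^sub>R h x)) = (\<lambda>x. w x *\<^sub>R (g x + c *\<^sub>R h x))"
      by (simp add: scaleR_add_right mult.commute)
    finally show ?thesis .
  qed
  then show ?thesis
    using locally_integrable_add_scaleR[OF loc(1,3), of c] locally_integrable_add_scaleR[OF loc(2,4), of c]
    unfolding has_weak_grad_def by simp
qed

lemma locally_integrable_continuous:
  assumes "continuous_on UNIV f" shows "locally_integrable D f"
  unfolding locally_integrable_def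
proof (intro allI impI)
  fix K assume "compact K \<and> K \<subseteq> D"
  then have K: "compact K" by simp
  have "integrable lborel (\<lambda>x. indicator K x *\<^sub>R f x)"
    by (rule borel_integrable_compact[OF K continuous_on_subset[OF assms subset_UNIV]])
  then have "integrable lebesgue (\<lambda>x. indicator K x *\<^sub>R f x)"
    by (subst integrable_completion) (auto dest: borel_measurable_integrable)
  then show "integrable (lebesgue_on K) f"
    using K by (subst integrable_restrict_space) (auto simp: lmeasurable_compact fmeasurableD)
qed

text \<open>Test functions vanish outside \<open>D\<close>, so the classical integration by parts on
  the whole space restricts to \<open>D\<close>.\<close>

lemma has_weak_grad_test_function:
  assumes D: "open D" and f: "f \<in> test_functions D"
  shows "has_weak_grad D f (grad f)"
  unfolding has_weak_grad_def
proof (intro conjI ballI locally_integrable_continuous continuous_on_test_function[OF f] continuous_on_grad[OF f])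
  fix v assume v: "v \<in> test_functions D"
  have DL: "D \<in> sets lebesgue"
    using D by (intro sets_completionI_sets) simp
  obtain K where K: "K \<subseteq> D" "\<And>x. x \<notin> K \<Longrightarrow> f x = 0"
    using test_function_support[OF f] by metis
  obtain L where L: "L \<subseteq> D" "\<And>x. x \<notin> L \<Longrightarrow> v x = 0"
    using test_function_support[OF v] by metis
  have zero: "f x = 0" "v x = 0" if "x \<notin> D" for x
    using that K L by auto
  note cont = continuous_on_test_function[OF f] continuous_on_grad[OF f]
    continuous_on_test_function[OF v] continuous_on_grad[OF v]
  have "(LINT x|lebesgue_on D. f x *\<^sub>R grad v x) = (LINT x|lborel. f x *\<^sub>R grad v x)"
    by (rule integral_lebesgue_on_eq_lborel[OF DL continuous_on_scaleR[OF cont(1,4)]]) (simp add: zero)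
  moreover have "(LINT x|lebesgue_on D. v x *\<^sub>R grad f x) = (LINT x|lborel. v x *\<^sub>R grad f x)"
    by (rule integral_lebesgue_on_eq_lborel[OF DL continuous_on_scaleR[OF cont(3,2)]]) (simp add: zero)
  ultimately show "(LINT x|lebesgue_on D. f x *\<^sub>R grad v x) = - (LINT x|lebesgue_on D. v x *\<^sub>R grad f x)"
    using integral_by_parts_test_functions[OF f v] by simp
qed

section \<open>Test functions as admissible variations, and changes on null sets\<close>

lemma Lp_compact_support:
  fixes f :: "'a::euclidean_space \<Rightarrow> 'b::euclidean_space"
  assumes D: "D \<in> sets lebesgue" and f: "continuous_on UNIV f" "compact K" "\<And>x. x \<notin> K \<Longrightarrow> f x = 0" and p: "p > 0"
  shows "f \<in> Lp p D"
proof -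
  have "f \<in> borel_measurable (lebesgue_on D)"
    by (rule borel_measurable_integrable[OF integrable_lebesgue_on_compact_support[OF D f]])
  moreover have "continuous_on UNIV (\<lambda>x. norm (f x) powr p)"
    using p by (intro continuous_on_powr' continuous_on_norm f(1) continuous_on_const) auto
  then have "integrable (lebesgue_on D) (\<lambda>x. norm (f x) powr p)"
    by (rule integrable_lebesgue_on_compact_support[OF D _ f(2)]) (simp add: f(3))
  ultimately show ?thesis by (simp add: Lp_def)
qed

lemma has_weak_grad_zero: "has_weak_grad D (\<lambda>x. 0) (\<lambda>x. 0)"
  by (simp add: has_weak_grad_def locally_integrable_def)

lemma
  assumes D: "open D" and f: "f \<in> test_functions D"
  shows test_function_in_Lp: "p > 0 \<Longrightarrow> f \<in> Lp p D"
    and test_function_in_W12_0: "f \<in> W12_0 D"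
proof -
  have DL: "D \<in> sets lebesgue"
    using D by (intro sets_completionI_sets) simp
  obtain K where K: "compact K" "K \<subseteq> D" "\<And>x. x \<notin> K \<Longrightarrow> f x = 0" "\<And>x. x \<notin> K \<Longrightarrow> grad f x = 0"
    using test_function_support[OF f] by metis
  show Lp: "f \<in> Lp p D" if "p > 0" for p
    by (rule Lp_compact_support[OF DL continuous_on_test_function[OF f] K(1,3) that])
  have "grad f \<in> Lp 2 D"
    by (rule Lp_compact_support[OF DL continuous_on_grad[OF f] K(1,4) zero_less_numeral])
  then have "f \<in> W12 D"
    using Lp[OF zero_less_numeral] has_weak_grad_test_function[OF D f] unfolding W12_def by blast
  \<comment> \<open>The constant sequence \<open>f\<close> approximates \<open>f\<close>. As
    \<open>weak_grad\<close> is an arbitrary choice, even the gradient of the zero function is known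
    to vanish only almost everywhere, by uniqueness.\<close>
  moreover have "W12_norm D (\<lambda>x. f x - f x) = 0"
  proof -
    have "(LINT x|lebesgue_on D. (norm (weak_grad D (\<lambda>x. 0) x))\<^sup>2) = 0"
      by (rule integral_eq_zero_AE, use AE_weak_grad_eq[OF D has_weak_grad_zero] in eventually_elim) simp
    then show ?thesis by (simp add: W12_norm_def)
  qed
  ultimately show "f \<in> W12_0 D"
    using f unfolding W12_0_def by (intro CollectI conjI exI[of _ "\<lambda>_. f"] allI) (simp_all only: tendsto_const)
qed

lemma Lp_cong_AE:
  fixes f g :: "'a::euclidean_space \<Rightarrow> 'b::euclidean_space"
  assumes g: "g \<in> Lp p D" and f [measurable]: "f \<in> borel_measurable (lebesgue_on D)"
    and eq: "AE x in lebesgue_on D. f x = g x"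
  shows "f \<in> Lp p D"
proof -
  have "integrable (lebesgue_on D) (\<lambda>x. norm (g x) powr p)"
    using g by (simp add: Lp_def)
  moreover have "(\<lambda>x. norm (f x) powr p) \<in> borel_measurable (lebesgue_on D)"
    by measurable
  moreover have "AE x in lebesgue_on D. norm (g x) powr p = norm (f x) powr p"
    using eq by eventually_elim (simp only:)
  ultimately have "integrable (lebesgue_on D) (\<lambda>x. norm (f x) powr p)"
    by (rule integrable_cong_AE_imp)
  with f show ?thesis
    unfolding Lp_def by blast
qed

text \<open>Rests on the completeness of Lebesgue measure. It is needed because the representative
  chosen by \<open>weak_grad\<close> is controlled only up to null sets.\<close>

lemma borel_measurable_lebesgue_on_cong_AE:
  fixes g :: "'a::euclidean_space \<Rightarrow> 'b::euclidean_space"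
  assumes D: "open D" and h: "h \<in> borel_measurable (lebesgue_on D)"
    and eq: "AE x in lebesgue_on D. g x = h x"
  shows "g \<in> borel_measurable (lebesgue_on D)"
proof -
  have DL: "D \<in> sets lebesgue"
    using D by (intro sets_completionI_sets) simp
  have ex: "AE x in lebesgue. (if x \<in> D then h x else 0) = (if x \<in> D then g x else 0)"
    using eq DL by (subst (asm) AE_restrict_space_iff) auto
  have "(\<lambda>x. if x \<in> D then h x else 0) \<in> borel_measurable lebesgue"
    using h DL by (rule borel_measurable_if_I)
  then have "(\<lambda>x. if x \<in> D then g x else 0) \<in> borel_measurable lebesgue"
    using ex by (rule borel_measurable_AE)
  then show ?thesis
    by (rule borel_measurable_if_D)
qed

section \<open>The first variation of the \<open>L\<^sup>p\<close> integral\<close>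

text \<open>Mean value theorem: for \<open>p \<ge> 1\<close> the derivative
  \<open>p * z powr (p - 1)\<close> is nondecreasing, hence at most its value at
  \<open>M\<close>.\<close>

lemma abs_powr_diff_le:
  fixes x y M p :: real
  assumes p: "p \<ge> 1" and xy: "0 \<le> x" "x \<le> M" "0 \<le> y" "y \<le> M"
  shows "\<bar>x powr p - y powr p\<bar> \<le> p * M powr (p - 1) * \<bar>x - y\<bar>"
proof -
  have *: "b powr p - a powr p \<le> p * M powr (p - 1) * (b - a)" if ab: "0 \<le> a" "a < b" "b \<le> M" for a b
  proof -
    have "\<exists>l z. a < z \<and> z < b \<and> DERIV (\<lambda>x. x powr p) z :> l \<and> b powr p - a powr p = (b - a) * l"
    proof (rule MVT[OF ab(2)])
      show "continuous_on {a..b} (\<lambda>x. x powr p)"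
        using p ab by (intro continuous_on_powr' continuous_on_id continuous_on_const) auto
      show "(\<lambda>x. x powr p) differentiable (at x)" if "a < x" "x < b" for x
        using has_real_derivative_powr[of x p] ab that real_differentiable_def by auto
    qed
    then obtain l z where z: "a < z" "z < b" "DERIV (\<lambda>x. x powr p) z :> l"
        and eq: "b powr p - a powr p = (b - a) * l"
      by blast
    have "l = p * z powr (p - 1)"
      using z ab by (intro DERIV_unique[OF z(3) has_real_derivative_powr]) simp
    also have "\<dots> \<le> p * M powr (p - 1)"
      using p z ab by (intro mult_left_mono powr_mono2) auto
    finally show ?thesis
      using eq ab by (simp add: mult.commute mult_left_mono)
  qed
  have mono: "a powr p \<le> b powr p" if "0 \<le> a" "a < b" for a b
    using that p by (intro powr_mono2) auto
  show ?thesis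
    using *[of x y] *[of y x] mono[of x y] mono[of y x] xy
    by (cases x y rule: linorder_cases) (auto simp: abs_if)
qed

text \<open>Supplies a majorant independent of \<open>t\<close> for dominated convergence: both
  arguments have absolute value at most \<open>\<bar>a\<bar> + \<bar>b\<bar>\<close>, and they
  differ by at most twice \<open>t * \<bar>b\<bar>\<close>.\<close>

lemma abs_powr_symmetric_quotient_le:
  fixes a b t p :: real
  assumes p: "p \<ge> 1" and t: "0 < t" "t \<le> 1"
  shows "\<bar>(\<bar>a + t * b\<bar> powr p - \<bar>a + - t * b\<bar> powr p) / (2 * t)\<bar> \<le> p * (\<bar>a\<bar> + \<bar>b\<bar>) powr p"
proof -
  define M where "M = \<bar>a\<bar> + \<bar>b\<bar>"
  have M: "0 \<le> M" "\<bar>b\<bar> \<le> M"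
    by (auto simp: M_def)
  have tb: "\<bar>t * b\<bar> \<le> \<bar>b\<bar>"
    using t by (simp add: abs_mult mult_left_le_one_le)
  have "\<bar>\<bar>a + t * b\<bar> powr p - \<bar>a + - t * b\<bar> powr p\<bar>
      \<le> p * M powr (p - 1) * \<bar>\<bar>a + t * b\<bar> - \<bar>a + - t * b\<bar>\<bar>"
    using tb by (intro abs_powr_diff_le[OF p]) (auto simp: M_def)
  also have "\<dots> \<le> p * M powr (p - 1) * (2 * t * M)"
  proof (intro mult_left_mono)
    have "t * \<bar>b\<bar> \<le> t * M"
      using M t by (intro mult_left_mono) auto
    moreover have "\<bar>\<bar>a + t * b\<bar> - \<bar>a + - t * b\<bar>\<bar> \<le> 2 * \<bar>t * b\<bar>"
      unfolding mult_minus_left by linarith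
    moreover have "\<bar>t * b\<bar> = t * \<bar>b\<bar>"
      using t by (simp add: abs_mult)
    ultimately show "\<bar>\<bar>a + t * b\<bar> - \<bar>a + - t * b\<bar>\<bar> \<le> 2 * t * M"
      by simp
  qed (use p in auto)
  also have "\<dots> = 2 * t * (p * M powr p)"
    using M by (cases "M = 0") (auto simp: powr_diff)
  finally show ?thesis
    using t unfolding M_def by (simp add: divide_le_eq abs_divide mult.commute)
qed

text \<open>On the side of \<open>0\<close> that contains \<open>a\<close>, the absolute value is
  the linear map \<open>x * sgn a\<close>, so the power rule and the chain rule apply.\<close>

lemma has_real_derivative_abs_powr:
  fixes a p :: real
  assumes "a \<noteq> 0"
  shows "((\<lambda>x. \<bar>x\<bar> powr p) has_real_derivative p * (\<bar>a\<bar> powr (p - 2) * a)) (at a)"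
proof -
  have "((\<lambda>x. x * sgn a) has_real_derivative sgn a) (at a)"
    by (auto intro!: derivative_eq_intros)
  note inner = this
  have pos: "0 < a * sgn a"
    using assms by (simp add: sgn_if)
  have "((\<lambda>x. (x * sgn a) powr p) has_real_derivative p * (a * sgn a) powr (p - 1) * sgn a) (at a)"
    by (rule DERIV_chain2[where f = "\<lambda>z. z powr p" and g = "\<lambda>x. x * sgn a", OF has_real_derivative_powr[OF pos] inner])
  also have "p * (a * sgn a) powr (p - 1) * sgn a = p * (\<bar>a\<bar> powr (p - 2) * a)"
  proof -
    have "\<bar>a\<bar> powr (p - 1) = \<bar>a\<bar> powr ((p - 2) + 1)"
      by simp
    also have "\<dots> = \<bar>a\<bar> powr (p - 2) * \<bar>a\<bar>"
      using assms by (simp only: powr_add powr_one abs_ge_zero)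
    finally show ?thesis
      using assms by (cases "0 < a") auto
  qed
  finally show ?thesis
    by (rule has_field_derivative_transform_within_open[of _ _ _ "{x. 0 < x * sgn a}"])
      (use assms pos in \<open>auto simp: sgn_if open_Collect_less continuous_intros split: if_splits\<close>)
qed

text \<open>The symmetric quotient is the average of the difference quotients with steps
  \<open>s n\<close> and \<open>- s n\<close>.\<close>

lemma symmetric_difference_quotient_tendsto:
  fixes f :: "real \<Rightarrow> real"
  assumes "(f has_real_derivative d) (at 0)"
    and s: "\<And>n. s n > 0" "s \<longlonglongrightarrow> 0"
  shows "(\<lambda>n. (f (s n) - f (- s n)) / (2 * s n)) \<longlonglongrightarrow> d"
proof -
  have lim: "((\<lambda>h. (f (0 + h) - f 0) / h) \<longlongrightarrow> d) (at 0)"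
    using assms(1) unfolding DERIV_def .
  have "filterlim s (at 0) sequentially" "filterlim (\<lambda>n. - s n) (at 0) sequentially"
    using s tendsto_minus[OF s(2)] unfolding filterlim_at
    by (auto intro!: always_eventually simp: less_imp_neq[symmetric])
  from filterlim_compose[OF lim this(1)] filterlim_compose[OF lim this(2)]
  have "(\<lambda>n. ((f (0 + s n) - f 0) / s n + (f (0 + - s n) - f 0) / (- s n)) / 2) \<longlonglongrightarrow> (d + d) / 2"
    by (intro tendsto_intros) auto
  moreover have "((f (0 + s n) - f 0) / s n + (f (0 + - s n) - f 0) / (- s n)) / 2 = (f (s n) - f (- s n)) / (2 * s n)" for n
    using s(1)[of n] by (simp add: field_simps)
  moreover have "(d + d) / 2 = d"
    by simp
  ultimately show ?thesis
    by (simp only:)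
qed

text \<open>For nonzero \<open>a\<close> this follows from differentiability. For
  \<open>a = 0\<close> the two powers agree by symmetry, so the quotients are \<open>0\<close>, as
  is the right-hand side through its factor \<open>a\<close>.\<close>

lemma abs_powr_symmetric_quotient_tendsto:
  fixes a b p :: real
  assumes s: "\<And>n. s n > 0" "s \<longlonglongrightarrow> 0"
  shows "(\<lambda>n. (\<bar>a + s n * b\<bar> powr p - \<bar>a + - s n * b\<bar> powr p) / (2 * s n))
    \<longlonglongrightarrow> p * (\<bar>a\<bar> powr (p - 2) * a * b)"
proof (cases "a = 0")
  case False
  have "((\<lambda>t. a + t * b) has_real_derivative b) (at 0)"
    by (auto intro!: derivative_eq_intros)
  moreover have "((\<lambda>x. \<bar>x\<bar> powr p) has_real_derivative p * (\<bar>a\<bar> powr (p - 2) * a)) (at (a + 0 * b))"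
    using has_real_derivative_abs_powr[OF False] by simp
  ultimately have "((\<lambda>t. \<bar>a + t * b\<bar> powr p) has_real_derivative p * (\<bar>a\<bar> powr (p - 2) * a) * b) (at 0)"
    by (rule DERIV_chain2[rotated])
  from symmetric_difference_quotient_tendsto[OF this s] show ?thesis
    by (simp add: mult.assoc)
qed simp

text \<open>Makes the majorant of the symmetric quotients integrable; the bound comes from replacing
  the sum by twice the maximum.\<close>

lemma integrable_powr_add:
  fixes f g :: "'a \<Rightarrow> real"
  assumes f: "integrable M (\<lambda>x. \<bar>f x\<bar> powr p)" and g: "integrable M (\<lambda>x. \<bar>g x\<bar> powr p)"
    and [measurable]: "f \<in> borel_measurable M" "g \<in> borel_measurable M" and p: "p \<ge> 0"
  shows "integrable M (\<lambda>x. (\<bar>f x\<bar> + \<bar>g x\<bar>) powr p)"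
proof (rule Bochner_Integration.integrable_bound)
  show "integrable M (\<lambda>x. 2 powr p * (\<bar>f x\<bar> powr p + \<bar>g x\<bar> powr p))"
    by (rule integrable_mult_right, rule Bochner_Integration.integrable_add[OF f g])
  show "AE x in M. norm ((\<bar>f x\<bar> + \<bar>g x\<bar>) powr p) \<le> norm (2 powr p * (\<bar>f x\<bar> powr p + \<bar>g x\<bar> powr p))"
  proof (rule AE_I2)
    fix x
    have "(\<bar>f x\<bar> + \<bar>g x\<bar>) powr p \<le> (2 * max \<bar>f x\<bar> \<bar>g x\<bar>) powr p"
      using p by (intro powr_mono2) auto
    also have "\<dots> = 2 powr p * max \<bar>f x\<bar> \<bar>g x\<bar> powr p"
      by (rule powr_mult)
    also have "\<dots> \<le> 2 powr p * (\<bar>f x\<bar> powr p + \<bar>g x\<bar> powr p)"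
      by (intro mult_left_mono) (auto simp: max_def)
    finally show "norm ((\<bar>f x\<bar> + \<bar>g x\<bar>) powr p) \<le> norm (2 powr p * (\<bar>f x\<bar> powr p + \<bar>g x\<bar> powr p))"
      by simp
  qed
qed measurable

text \<open>Where \<open>f = 0\<close> and \<open>p = 1\<close> the integrand is not differentiable at \<open>t = 0\<close>, but its symmetric
  difference quotients vanish, in accordance with \<open>0 powr (p - 2) = 0\<close>.\<close>

lemma
  fixes f g :: "'a \<Rightarrow> real"
  assumes f: "integrable M (\<lambda>x. \<bar>f x\<bar> powr p)" and g: "integrable M (\<lambda>x. \<bar>g x\<bar> powr p)"
    and meas [measurable]: "f \<in> borel_measurable M" "g \<in> borel_measurable M" and p: "p \<ge> 1"
  shows integrable_powr_variation: "integrable M (\<lambda>x. \<bar>f x\<bar> powr (p - 2) * f x * g x)"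
    and integral_powr_variation:
      "((\<lambda>t. LINT x|M. \<bar>f x + t * g x\<bar> powr p) has_real_derivative d) (at 0) \<Longrightarrow>
       d = p * (LINT x|M. \<bar>f x\<bar> powr (p - 2) * f x * g x)"
proof -
  define s where "s n = inverse (real (Suc n))" for n
  have s: "s n > 0" "s n \<le> 1" for n
    by (auto simp: s_def field_simps)
  have s0: "s \<longlonglongrightarrow> 0"
    unfolding s_def by (rule LIMSEQ_inverse_real_of_nat)
  define q where "q n x = (\<bar>f x + s n * g x\<bar> powr p - \<bar>f x + - s n * g x\<bar> powr p) / (2 * s n)" for n x
  define w where "w x = p * (\<bar>f x\<bar> + \<bar>g x\<bar>) powr p" for x
  have fg: "integrable M (\<lambda>x. (\<bar>f x\<bar> + \<bar>g x\<bar>) powr p)"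
    using p by (intro integrable_powr_add[OF f g meas]) simp
  then have w: "integrable M w"
    unfolding w_def by (rule integrable_mult_right)
  have lim: "AE x in M. (\<lambda>n. q n x) \<longlonglongrightarrow> p * (\<bar>f x\<bar> powr (p - 2) * f x * g x)"
    unfolding q_def by (intro AE_I2 abs_powr_symmetric_quotient_tendsto s s0)
  have bound: "AE x in M. norm (q n x) \<le> w x" for n
    unfolding q_def w_def real_norm_def by (intro AE_I2 abs_powr_symmetric_quotient_le p s)
  have q_meas: "q n \<in> borel_measurable M" for n
    unfolding q_def by measurable
  have lim_meas: "(\<lambda>x. p * (\<bar>f x\<bar> powr (p - 2) * f x * g x)) \<in> borel_measurable M"
    by measurable
  \<comment> \<open>Dominated convergence also yields integrability of the limit, before any
    differentiability is assumed.\<close>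
  have "integrable M (\<lambda>x. p * (\<bar>f x\<bar> powr (p - 2) * f x * g x))"
    by (rule integrable_dominated_convergence[OF lim_meas q_meas w lim bound])
  then have "integrable M (\<lambda>x. 1 / p * (p * (\<bar>f x\<bar> powr (p - 2) * f x * g x)))"
    by (rule integrable_mult_right)
  then show "integrable M (\<lambda>x. \<bar>f x\<bar> powr (p - 2) * f x * g x)"
    using p by simp
  have int: "integrable M (\<lambda>x. \<bar>f x + t * g x\<bar> powr p)" if "\<bar>t\<bar> \<le> 1" for t
  proof (rule Bochner_Integration.integrable_bound[OF fg])
    have "\<bar>f x + t * g x\<bar> \<le> \<bar>f x\<bar> + \<bar>g x\<bar>" for x
    proof -
      have "\<bar>f x + t * g x\<bar> \<le> \<bar>f x\<bar> + \<bar>t\<bar> * \<bar>g x\<bar>"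
        using abs_triangle_ineq[of "f x" "t * g x"] by (simp add: abs_mult)
      also have "\<dots> \<le> \<bar>f x\<bar> + \<bar>g x\<bar>"
        using that by (intro add_left_mono mult_left_le_one_le) auto
      finally show ?thesis .
    qed
    then have "\<bar>f x + t * g x\<bar> powr p \<le> (\<bar>f x\<bar> + \<bar>g x\<bar>) powr p" for x
      using p by (intro powr_mono2) auto
    then show "AE x in M. norm (\<bar>f x + t * g x\<bar> powr p) \<le> norm ((\<bar>f x\<bar> + \<bar>g x\<bar>) powr p)"
      by (intro AE_I2) simp
  qed measurable
  define N where "N t = (LINT x|M. \<bar>f x + t * g x\<bar> powr p)" for t
  have "(LINT x|M. q n x) = (N (s n) - N (- s n)) / (2 * s n)" for n
    unfolding q_def N_def integral_divide_zero using s[of n] int[of "s n"] int[of "- s n"]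
    by (subst Bochner_Integration.integral_diff) simp_all
  then have lim_N: "(\<lambda>n. (N (s n) - N (- s n)) / (2 * s n)) \<longlonglongrightarrow>
      p * (LINT x|M. \<bar>f x\<bar> powr (p - 2) * f x * g x)"
    using integral_dominated_convergence[OF lim_meas q_meas w lim bound] by simp
  assume "((\<lambda>t. LINT x|M. \<bar>f x + t * g x\<bar> powr p) has_real_derivative d) (at 0)"
  then have "(N has_real_derivative d) (at 0)"
    unfolding N_def[abs_def] .
  \<comment> \<open>Convergence of symmetric quotients alone would not give a derivative; with
    differentiability assumed, it identifies its value.\<close>
  from symmetric_difference_quotient_tendsto[OF this s(1) s0] lim_N
  show "d = p * (LINT x|M. \<bar>f x\<bar> powr (p - 2) * f x * g x)"
    by (rule LIMSEQ_unique)
qed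

text \<open>Solving the quotient for its denominator shows that the denominator inherits
  differentiability from the quotient and the numerator.\<close>

lemma denominator_has_derivative_if_quotient_critical:
  fixes E N :: "real \<Rightarrow> real"
  assumes p: "p > 0" and N: "\<And>t. N t \<ge> 0" and N0: "N 0 > 0" and E0: "E 0 \<noteq> 0"
    and E: "(E has_real_derivative e) (at 0)"
    and Q: "((\<lambda>t. E t / N t powr (2 / p)) has_real_derivative 0) (at 0)"
  shows "(N has_real_derivative p * N 0 * e / (2 * E 0)) (at 0)"
proof -
  define Q where "Q t = E t / N t powr (2 / p)" for t
  have Q0: "Q 0 \<noteq> 0"
    using N0 E0 by (simp add: Q_def)
  have dQ: "(Q has_real_derivative 0) (at 0)"
    using Q unfolding Q_def .
  define c where "c = N 0 powr (2 / p)"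
  \<comment> \<open>\<open>E 0\<close> is only known to be nonzero, but \<open>E 0 / Q 0\<close>
    equals \<open>c\<close> and so is positive, as the power rule below requires.\<close>
  have c: "c > 0" "E 0 / Q 0 = c"
    using N0 E0 by (auto simp: Q_def c_def)
  have "((\<lambda>t. E t / Q t) has_real_derivative (e * Q 0 - E 0 * 0) / (Q 0 * Q 0)) (at 0)"
    by (rule DERIV_divide[OF E dQ Q0])
  then have "((\<lambda>t. E t / Q t) has_real_derivative e / Q 0) (at 0)"
    using Q0 by simp
  moreover have pos: "E 0 / Q 0 > 0"
    using c by simp
  ultimately have "((\<lambda>t. (E t / Q t) powr (p / 2)) has_real_derivative
      (p / 2 * (E 0 / Q 0) powr (p / 2 - 1)) * (e / Q 0)) (at 0)"
    by (intro DERIV_chain2[where f = "\<lambda>z. z powr (p / 2)" and g = "\<lambda>t. E t / Q t", OF has_real_derivative_powr])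
  also have "(p / 2 * (E 0 / Q 0) powr (p / 2 - 1)) * (e / Q 0) = p * N 0 * e / (2 * E 0)"
  proof -
    have "c powr (p / 2) = N 0"
      using p N0 by (simp add: c_def powr_powr)
    then have 1: "(E 0 / Q 0) powr (p / 2 - 1) = N 0 / c"
      using c unfolding c(2) powr_diff by simp
    have 2: "e / Q 0 = e * (c / E 0)"
      using E0 by (simp flip: c(2))
    show ?thesis
      unfolding 1 2 using c(1) E0 by (simp add: field_simps)
  qed
  finally have *: "((\<lambda>t. (E t / Q t) powr (p / 2)) has_real_derivative p * N 0 * e / (2 * E 0)) (at 0)" .
  \<comment> \<open>By continuity \<open>Q\<close> stays nonzero near \<open>0\<close>. Where
    \<open>Q t\<close> is nonzero, neither \<open>E t\<close> nor \<open>N t\<close> vanishes, since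
    division by zero yields \<open>0\<close>; so the quotient can be solved for \<open>N t\<close>
    there.\<close>
  have "isCont Q 0"
    using dQ by (rule DERIV_isCont)
  then have "eventually (\<lambda>t. Q t \<noteq> 0) (nhds 0)"
    using tendsto_imp_eventually_ne[of Q "Q 0" "at 0" 0] Q0
    unfolding isCont_def eventually_nhds_conv_at by blast
  then have "eventually (\<lambda>t. (E t / Q t) powr (p / 2) = N t) (nhds 0)"
  proof eventually_elim
    case (elim t)
    then have "E t \<noteq> 0" "N t > 0"
      using N[of t] by (auto simp: Q_def less_le)
    then have "E t / Q t = N t powr (2 / p)"
      by (simp add: Q_def)
    then show ?case
      using p \<open>N t > 0\<close> by (simp add: powr_powr)
  qed
  from DERIV_cong_ev[OF refl this refl] * show ?thesis
    by blast
qed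

section \<open>The Euler--Lagrange equation\<close>

lemma integrable_norm_sq_if_L2: "f \<in> Lp 2 D \<Longrightarrow> integrable (lebesgue_on D) (\<lambda>x. (norm (f x))\<^sup>2)"
  by (simp add: Lp_def)

text \<open>\<open>W12\<close> provides some square-integrable gradient; uniqueness transfers this
  to the chosen representative.\<close>

lemma weak_grad_L2:
  assumes D: "open D" and u: "u \<in> W12 D"
  shows "has_weak_grad D u (weak_grad D u)" "weak_grad D u \<in> Lp 2 D"
proof -
  obtain h where h: "h \<in> Lp 2 D" "has_weak_grad D u h"
    using u by (auto simp: W12_def)
  show "has_weak_grad D u (weak_grad D u)"
    by (rule weak_grad_works[OF h(2)])
  have eq: "AE x in lebesgue_on D. weak_grad D u x = h x"
    by (rule AE_weak_grad_eq[OF D h(2)])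
  have "h \<in> borel_measurable (lebesgue_on D)"
    using h(1) by (simp add: Lp_def)
  from Lp_cong_AE[OF h(1) borel_measurable_lebesgue_on_cong_AE[OF D this eq] eq]
  show "weak_grad D u \<in> Lp 2 D" .
qed

lemma integrable_inner_L2:
  fixes f g :: "'a::euclidean_space \<Rightarrow> 'b::euclidean_space"
  assumes f: "f \<in> Lp 2 D" and g: "g \<in> Lp 2 D"
  shows "integrable (lebesgue_on D) (\<lambda>x. f x \<bullet> g x)"
proof (rule Bochner_Integration.integrable_bound)
  show "integrable (lebesgue_on D) (\<lambda>x. (norm (f x))\<^sup>2 + (norm (g x))\<^sup>2)"
    by (intro Bochner_Integration.integrable_add integrable_norm_sq_if_L2 f g)
  show "(\<lambda>x. f x \<bullet> g x) \<in> borel_measurable (lebesgue_on D)"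
    using f g by (intro borel_measurable_inner) (simp_all add: Lp_def)
  have "\<bar>f x \<bullet> g x\<bar> \<le> (norm (f x))\<^sup>2 + (norm (g x))\<^sup>2" for x
  proof -
    have "0 \<le> (norm (f x) - norm (g x))\<^sup>2"
      by simp
    then have "2 * (norm (f x) * norm (g x)) \<le> (norm (f x))\<^sup>2 + (norm (g x))\<^sup>2"
      by (simp add: power2_diff)
    moreover have "0 \<le> norm (f x) * norm (g x)"
      by simp
    ultimately show ?thesis
      using Cauchy_Schwarz_ineq2[of "f x" "g x"] by linarith
  qed
  then show "AE x in lebesgue_on D. norm (f x \<bullet> g x) \<le> norm ((norm (f x))\<^sup>2 + (norm (g x))\<^sup>2)"
    by (intro AE_I2) simp
qed

text \<open>By uniqueness, the gradient chosen for the combination agrees almost everywhere with the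
  combination of the chosen gradients; expanding the squared norm gives a polynomial in
  \<open>c\<close>.\<close>

lemma Dirichlet_energy_add_mult:
  assumes D: "open D" and u: "u \<in> W12 D" and v: "v \<in> W12 D"
  shows "(LINT x|lebesgue_on D. (norm (weak_grad D (\<lambda>x. u x + c * v x) x))\<^sup>2) =
    (LINT x|lebesgue_on D. (norm (weak_grad D u x))\<^sup>2) +
    2 * c * (LINT x|lebesgue_on D. weak_grad D u x \<bullet> weak_grad D v x) +
    c\<^sup>2 * (LINT x|lebesgue_on D. (norm (weak_grad D v x))\<^sup>2)"
proof -
  define g h where "g = weak_grad D u" and "h = weak_grad D v"
  note gh = weak_grad_L2[OF D u, folded g_def] weak_grad_L2[OF D v, folded h_def]
  have DL: "D \<in> sets lebesgue"
    using D by (intro sets_completionI_sets) simp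
  have AE: "AE x in lebesgue_on D. weak_grad D (\<lambda>x. u x + c * v x) x = g x + c *\<^sub>R h x"
    by (rule AE_weak_grad_eq[OF D has_weak_grad_add_mult[OF DL gh(1,3)]])
  note int = integrable_norm_sq_if_L2[OF gh(2)] integrable_inner_L2[OF gh(2,4)] integrable_norm_sq_if_L2[OF gh(4)]
  have int': "integrable (lebesgue_on D) (\<lambda>x. (norm (g x))\<^sup>2 + 2 * c * (g x \<bullet> h x))"
    by (rule Bochner_Integration.integrable_add[OF int(1) integrable_mult_right[OF int(2)]])
  have int'': "integrable (lebesgue_on D) (\<lambda>x. (norm (g x))\<^sup>2 + 2 * c * (g x \<bullet> h x) + c\<^sup>2 * (norm (h x))\<^sup>2)"
    by (rule Bochner_Integration.integrable_add[OF int' integrable_mult_right[OF int(3)]])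
  have expand: "(norm (g x + c *\<^sub>R h x))\<^sup>2 = (norm (g x))\<^sup>2 + 2 * c * (g x \<bullet> h x) + c\<^sup>2 * (norm (h x))\<^sup>2" for x
    unfolding power2_norm_eq_inner inner_add_left inner_add_right inner_scaleR_left inner_scaleR_right
      inner_commute[of "h x" "g x"]
    by algebra
  have meas_g: "g \<in> borel_measurable (lebesgue_on D)" "h \<in> borel_measurable (lebesgue_on D)"
    using gh by (auto simp: Lp_def)
  have sum_meas: "(\<lambda>x. g x + c *\<^sub>R h x) \<in> borel_measurable (lebesgue_on D)"
    by (intro borel_measurable_add borel_measurable_scaleR borel_measurable_const meas_g)
  have "(LINT x|lebesgue_on D. (norm (weak_grad D (\<lambda>x. u x + c * v x) x))\<^sup>2) =
      (LINT x|lebesgue_on D. (norm (g x))\<^sup>2 + 2 * c * (g x \<bullet> h x) + c\<^sup>2 * (norm (h x))\<^sup>2)"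
  proof (rule integral_cong_AE)
    show "(\<lambda>x. (norm (weak_grad D (\<lambda>x. u x + c * v x) x))\<^sup>2) \<in> borel_measurable (lebesgue_on D)"
      using borel_measurable_lebesgue_on_cong_AE[OF D sum_meas AE] by measurable
    show "(\<lambda>x. (norm (g x))\<^sup>2 + 2 * c * (g x \<bullet> h x) + c\<^sup>2 * (norm (h x))\<^sup>2) \<in> borel_measurable (lebesgue_on D)"
      by (rule borel_measurable_integrable[OF int''])
    show "AE x in lebesgue_on D. (norm (weak_grad D (\<lambda>x. u x + c * v x) x))\<^sup>2 =
        (norm (g x))\<^sup>2 + 2 * c * (g x \<bullet> h x) + c\<^sup>2 * (norm (h x))\<^sup>2"
      using AE by eventually_elim (simp only: expand)
  qed
  also have "\<dots> = (LINT x|lebesgue_on D. (norm (g x))\<^sup>2) + 2 * c * (LINT x|lebesgue_on D. g x \<bullet> h x) +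
      c\<^sup>2 * (LINT x|lebesgue_on D. (norm (h x))\<^sup>2)"
    by (simp only: Bochner_Integration.integral_add[OF int' integrable_mult_right[OF int(3)]]
      Bochner_Integration.integral_add[OF int(1) integrable_mult_right[OF int(2)]] integral_mult_right_zero)
  finally show ?thesis
    unfolding g_def h_def .
qed

text \<open>Criticality is tested in the direction of each test function \<open>v\<close>. The
  resulting factor \<open>E0 / N0\<close> is independent of \<open>v\<close>, so one multiplier
  serves all of them.\<close>

lemma critical_point_imp_weak_solution:
  fixes D :: "'a::euclidean_space set"
  assumes D: "open D" and p: "p \<ge> 1" and crit: "critical_point D p u"
  shows "\<exists>\<Lambda>. weak_solution D p \<Lambda> u"
proof -
  have DL: "D \<in> sets lebesgue"
    using D by (intro sets_completionI_sets) simp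
  have uLp: "u \<in> Lp p D" and uW: "u \<in> W12 D" and u_nz: "\<not> (AE x in lebesgue_on D. u x = 0)"
    using crit by (auto simp: critical_point_def W12_0_def)
  define g where "g = weak_grad D u"
  note g = weak_grad_L2[OF D uW, folded g_def]
  have g_loc: "locally_integrable D g"
    using g(1) by (simp add: has_weak_grad_def)
  have u_meas: "u \<in> borel_measurable (lebesgue_on D)"
    and u_int: "integrable (lebesgue_on D) (\<lambda>x. \<bar>u x\<bar> powr p)"
    using uLp by (auto simp: Lp_def)
  define E0 where "E0 = (LINT x|lebesgue_on D. (norm (g x))\<^sup>2)"
  define N0 where "N0 = (LINT x|lebesgue_on D. \<bar>u x\<bar> powr p)"
  have E0: "E0 \<ge> 0"
    by (simp add: E0_def)
  have N0: "N0 > 0"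
  proof (rule ccontr)
    assume "\<not> N0 > 0"
    moreover have "N0 \<ge> 0"
      by (simp add: N0_def)
    ultimately have "N0 = 0" by simp
    then have "AE x in lebesgue_on D. \<bar>u x\<bar> powr p = 0"
      unfolding N0_def by (subst (asm) integral_nonneg_eq_0_iff_AE[OF u_int]) auto
    then have "AE x in lebesgue_on D. u x = 0"
      by eventually_elim simp
    with u_nz show False ..
  qed
  have v_props: "v \<in> W12 D" "v \<in> Lp p D \<inter> W12_0 D" "v \<in> borel_measurable (lebesgue_on D)"
      "integrable (lebesgue_on D) (\<lambda>x. \<bar>v x\<bar> powr p)"
      "AE x in lebesgue_on D. weak_grad D v x = grad v x"
    if v: "v \<in> test_functions D" for v
  proof -
    show *: "v \<in> Lp p D \<inter> W12_0 D"
      using test_function_in_Lp[OF D v, of p] test_function_in_W12_0[OF D v] p by simp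
    then show "v \<in> W12 D" "v \<in> borel_measurable (lebesgue_on D)" "integrable (lebesgue_on D) (\<lambda>x. \<bar>v x\<bar> powr p)"
      by (auto simp: W12_0_def Lp_def)
    show "AE x in lebesgue_on D. weak_grad D v x = grad v x"
      by (rule AE_weak_grad_eq[OF D has_weak_grad_test_function[OF D v]])
  qed
  have Euler_Lagrange: "(LINT x|lebesgue_on D. g x \<bullet> grad v x) =
      E0 / N0 * (LINT x|lebesgue_on D. \<bar>u x\<bar> powr (p - 2) * u x * v x)"
    if v: "v \<in> test_functions D" for v
  proof (cases "E0 = 0")
    \<comment> \<open>Zero energy forces the gradient of \<open>u\<close> to vanish almost
      everywhere, so both sides are \<open>0\<close>.\<close>
    case True
    then have "AE x in lebesgue_on D. (norm (g x))\<^sup>2 = 0"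
      unfolding E0_def by (subst (asm) integral_nonneg_eq_0_iff_AE[OF integrable_norm_sq_if_L2[OF g(2)]]) auto
    then have "AE x in lebesgue_on D. g x \<bullet> grad v x = 0"
      by eventually_elim simp
    then have "(LINT x|lebesgue_on D. g x \<bullet> grad v x) = 0"
      by (rule integral_eq_zero_AE)
    with True show ?thesis by simp
  next
    case False
    define E where "E t = (LINT x|lebesgue_on D. (norm (weak_grad D (\<lambda>x. u x + t * v x) x))\<^sup>2)" for t
    define N where "N t = (LINT x|lebesgue_on D. \<bar>u x + t * v x\<bar> powr p)" for t
    define I where "I = (LINT x|lebesgue_on D. g x \<bullet> weak_grad D v x)"
    have E_eq: "E t = E0 + 2 * t * I + t\<^sup>2 * (LINT x|lebesgue_on D. (norm (weak_grad D v x))\<^sup>2)" for t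
      unfolding E_def E0_def I_def g_def by (rule Dirichlet_energy_add_mult[OF D uW v_props(1)[OF v]])
    have dE: "(E has_real_derivative 2 * I) (at 0)"
      unfolding E_eq[abs_def] by (auto intro!: derivative_eq_intros)
    have at_0: "E 0 = E0" "N 0 = N0"
      by (simp_all add: E_def N_def E0_def N0_def g_def)
    have "((\<lambda>t. E t / N t powr (2 / p)) has_real_derivative 0) (at 0)"
      using crit v_props(2)[OF v] unfolding critical_point_def Phi_def E_def N_def by blast
    then have "(N has_real_derivative p * N 0 * (2 * I) / (2 * E 0)) (at 0)"
      using p N0 E0 False dE by (intro denominator_has_derivative_if_quotient_critical) (auto simp: at_0, simp add: N_def)
    \<comment> \<open>Two values of the derivative of \<open>N\<close> at \<open>0\<close> are
      equated: one from solving the critical quotient for \<open>N\<close>, one from symmetric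
      quotients.\<close>
    then have "p * N 0 * (2 * I) / (2 * E 0) = p * (LINT x|lebesgue_on D. \<bar>u x\<bar> powr (p - 2) * u x * v x)"
      unfolding N_def[abs_def]
      by (intro integral_powr_variation[OF u_int v_props(4)[OF v] u_meas v_props(3)[OF v] p])
    then have "I = E0 / N0 * (LINT x|lebesgue_on D. \<bar>u x\<bar> powr (p - 2) * u x * v x)"
      using p N0 False by (simp add: at_0 field_simps)
    \<comment> \<open>The chosen weak gradient of \<open>v\<close> is replaced by the classical one,
      which occurs in the weak equation.\<close>
    moreover have "I = (LINT x|lebesgue_on D. g x \<bullet> grad v x)"
      unfolding I_def
    proof (rule integral_cong_AE)
      show "(\<lambda>x. g x \<bullet> grad v x) \<in> borel_measurable (lebesgue_on D)"
        by (rule borel_measurable_integrable[OF integrable_inner_grad[OF DL v g_loc]])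
      show "(\<lambda>x. g x \<bullet> weak_grad D v x) \<in> borel_measurable (lebesgue_on D)"
        by (rule borel_measurable_integrable[OF integrable_inner_L2[OF g(2) weak_grad_L2(2)[OF D v_props(1)[OF v]]]])
      show "AE x in lebesgue_on D. g x \<bullet> weak_grad D v x = g x \<bullet> grad v x"
        using v_props(5)[OF v] by eventually_elim simp
    qed
    ultimately show ?thesis by simp
  qed
  have "weak_solution D p (E0 / N0) u"
    unfolding weak_solution_def
  proof (intro ballI conjI)
    fix v assume v: "v \<in> test_functions D"
    have 1: "integrable (lebesgue_on D) (\<lambda>x. - (weak_grad D u x \<bullet> grad v x))"
      using integrable_inner_grad[OF DL v g_loc] unfolding g_def by (rule Bochner_Integration.integrable_minus)
    have "integrable (lebesgue_on D) (\<lambda>x. E0 / N0 * (\<bar>u x\<bar> powr (p - 2) * u x * v x))"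
      by (intro integrable_mult_right integrable_powr_variation u_int u_meas v_props v p)
    then have 2: "integrable (lebesgue_on D) (\<lambda>x. E0 / N0 * (\<bar>u x\<bar> powr (p - 2) * u x) * v x)"
      by (simp only: mult.assoc)
    show "integrable (lebesgue_on D)
        (\<lambda>x. - (weak_grad D u x \<bullet> grad v x) + E0 / N0 * (\<bar>u x\<bar> powr (p - 2) * u x) * v x)"
      by (rule Bochner_Integration.integrable_add[OF 1 2])
    have "(LINT x|lebesgue_on D. - (weak_grad D u x \<bullet> grad v x) + E0 / N0 * (\<bar>u x\<bar> powr (p - 2) * u x) * v x)
        = - (LINT x|lebesgue_on D. g x \<bullet> grad v x) + (LINT x|lebesgue_on D. E0 / N0 * (\<bar>u x\<bar> powr (p - 2) * u x) * v x)"
      unfolding Bochner_Integration.integral_add[OF 1 2] g_def by simp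
    also have "(LINT x|lebesgue_on D. E0 / N0 * (\<bar>u x\<bar> powr (p - 2) * u x) * v x)
        = E0 / N0 * (LINT x|lebesgue_on D. \<bar>u x\<bar> powr (p - 2) * u x * v x)"
      unfolding mult.assoc by (rule integral_mult_right_zero)
    finally show "(LINT x|lebesgue_on D. - (weak_grad D u x \<bullet> grad v x) + E0 / N0 * (\<bar>u x\<bar> powr (p - 2) * u x) * v x) = 0"
      using Euler_Lagrange[OF v] by simp
  qed
  then show ?thesis ..
qed

theorem theorem1:
  fixes D :: "(real ^ 'n) set" and p :: real and u :: "real ^ 'n \<Rightarrow> real"
  assumes "CARD('n) \<ge> 2"
    and "open D" and "connected D" and "D \<noteq> {}" and "bounded D" and "smooth_boundary D"
    and "p \<ge> 1"
    and "critical_point D p u"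
  shows "\<exists>\<Lambda>. weak_solution D p \<Lambda> u \<and> u \<in> W12_0 D"
  using critical_point_imp_weak_solution[OF assms(2,7,8)] assms(8) by (auto simp: critical_point_def)

end
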